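(* Let $G$ be a $\sigma$-compact, locally compact, unimodular amenable group and suppose that $(F_N)_{N\ge 1}$ is a symmetric F{\o}lner sequence for $G$ such that $\bigcup_{N\ge1}F_N=G$ and such that there exist $p\in\mathbb{N}\setminus\{0\}$ and $K>0$ with $$F_N\cdot F_N^{-1}\subset F_{pN}\qquad\text{and}\qquad \frac{|F_{pN}|}{|F_N|}\le K$$ for every $N\ge 1$. Let $\pi:G\to\mathcal{B}(\mathcal{H})$ be a strongly continuous representation of $G$ by invertible operators on a complex Hilbert space $\mathcal{H}$ for which there is a constant $C\ge1$ such that, for every $N\ge 1$ and every $x\in\mathcal{H}$, $$\frac{1}{|F_N|}\int_{F_N}\|\pi(g)x\|^2\,\mathrm{d}m(g)\le C^2\|x\|^2$$ and $$\frac{1}{|F_N|}\int_{F_N}\|\pi(g)^{*}x\|^2\,\mathrm{d}m(g)\le C^2\|x\|^2 .$$ Then $\pi$ is unitarizable.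
   Context: $m$ denotes a right invariant Haar measure on $G$, and $|E|=m(E)$ for measurable $E\subset G$. For $A,B\subset G$ and $s\in G$: $A^{-1}=\{a^{-1}:a\in A\}$, $A\cdot B=\{ab:a\in A,b\in B\}$, $As=\{as:a\in A\}$, and $A\triangle B=(A\setminus B)\cup(B\setminus A)$. A symmetric F{\o}lner sequence is a sequence $(F_N)_{N\ge1}$ of compact subsets of $G$ with $0<|F_N|<\infty$, $F_N^{-1}=F_N$, and $$\lim_{N\to\infty}\frac{|F_Ns\,\triangle\,F_N|}{|F_N|}=0\quad\text{for every } s\in G.$$ $\mathcal{B}(\mathcal{H})$ is the algebra of bounded linear operators on $\mathcal{H}$. A (strongly) continuous representation of $G$ is a map $\pi:G\to\mathcal{B}(\mathcal{H})$ with $\pi(1)=I$, $\pi(g_1g_2)=\pi(g_1)\pi(g_2)$ for all $g_1,g_2\in G$, continuous for the strong operator topology on $\mathcal{B}(\mathcal{H})$. It is a unitary representation if $\pi(g)^*\pi(g)=I=\pi(g)\pi(g)^*$ for all $g\in G$. $\pi$ is unitarizable if there is an invertible $L\in\mathcal{B}(\mathcal{H})$ such that $g\mapsto L^{-1}\pi(g)L$ is a unitary representation. *)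

theory Defs
  imports "HOL-Analysis.Analysis"
begin

text \<open>
  Topological groups are those of the library, class \<^class>\<open>topological_group_add\<close>, which does
  not assume commutativity.  The group law is therefore written additively: \<open>g + h\<close>, \<open>- g\<close>, \<open>0\<close>
  stand for \<open>gh\<close>, \<open>g\<inverse>\<close>, \<open>1\<close>.
\<close>

subsection \<open>Haar measure, amenability, Folner sequences\<close>

definition sigma_compact_space :: "'a topology \<Rightarrow> bool" where
  "sigma_compact_space X \<longleftrightarrow>
     (\<exists>K :: nat \<Rightarrow> 'a set. (\<forall>n. compactin X (K n)) \<and> (\<Union>n. K n) = topspace X)"

definition radon_measure :: "'a::t2_space measure \<Rightarrow> bool" where
  "radon_measure m \<longleftrightarrow>
     sets m = sets borel \<and>
     (\<forall>K. compact K \<longrightarrow> emeasure m K < \<infinity>) \<and>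
     (\<forall>A\<in>sets borel. emeasure m A = (INF U\<in>{U. open U \<and> A \<subseteq> U}. emeasure m U)) \<and>
     (\<forall>U. open U \<longrightarrow> emeasure m U = (SUP K\<in>{K. compact K \<and> K \<subseteq> U}. emeasure m K))"

definition right_haar_measure ::
    "'g::{topological_group_add,t2_space} measure \<Rightarrow> bool" where
  "right_haar_measure m \<longleftrightarrow>
     radon_measure m \<and> emeasure m UNIV \<noteq> 0 \<and>
     (\<forall>A\<in>sets borel. \<forall>s. emeasure m ((\<lambda>a. a + s) ` A) = emeasure m A)"

text \<open>
  A group is unimodular when its modular function is trivial, i.e. when a right Haar measure
  (the predicate is applied only to such measures) is also left invariant.
\<close>

definition unimodular :: "'g::{topological_group_add,t2_space} measure \<Rightarrow> bool" where
  "unimodular m \<longleftrightarrow>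
     (\<forall>A\<in>sets borel. \<forall>s. emeasure m ((\<lambda>a. s + a) ` A) = emeasure m A)"

definition Linfty :: "'a measure \<Rightarrow> ('a \<Rightarrow> real) set" where
  "Linfty m = {f \<in> borel_measurable m. \<exists>B. AE x in m. \<bar>f x\<bar> \<le> B}"

text \<open>
  Amenability: there is a left invariant mean on \<open>L\<^sup>\<infinity>(G, m)\<close>, \<open>m\<close> a Haar measure.  The mean is a
  functional on representatives; positivity, being required for functions that are nonnegative
  almost everywhere, forces it to depend only on the class modulo null sets.
\<close>

definition amenable :: "'g::{topological_group_add,t2_space} measure \<Rightarrow> bool" where
  "amenable m \<longleftrightarrow>
     (\<exists>M :: ('g \<Rightarrow> real) \<Rightarrow> real.
        (\<forall>f\<in>Linfty m. \<forall>h\<in>Linfty m. M (\<lambda>x. f x + h x) = M f + M h) \<and>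
        (\<forall>f\<in>Linfty m. \<forall>c. M (\<lambda>x. c * f x) = c * M f) \<and>
        (\<forall>f\<in>Linfty m. (AE x in m. 0 \<le> f x) \<longrightarrow> 0 \<le> M f) \<and>
        M (\<lambda>x. 1) = 1 \<and>
        (\<forall>f\<in>Linfty m. \<forall>s. M (\<lambda>x. f (s + x)) = M f))"

text \<open>Sequences are indexed by \<open>N \<ge> 1\<close>; the value at \<open>0\<close> plays no role.\<close>

definition symmetric_folner_sequence ::
    "'g::{topological_group_add,t2_space} measure \<Rightarrow> (nat \<Rightarrow> 'g set) \<Rightarrow> bool" where
  "symmetric_folner_sequence m F \<longleftrightarrow>
     (\<forall>N\<ge>1. compact (F N) \<and> 0 < emeasure m (F N) \<and> emeasure m (F N) < \<infinity> \<and>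
             uminus ` F N = F N) \<and>
     (\<forall>s. (\<lambda>N. measure m (sym_diff ((\<lambda>a. a + s) ` F N) (F N)) / measure m (F N))
            \<longlonglongrightarrow> 0)"


subsection \<open>Complex Hilbert spaces and their bounded operators\<close>

text \<open>
  A complex Hilbert space is presented over its underlying real Hilbert space, whose inner product
  is the real part of the complex one; in particular \<open>norm x = sqrt (Re (cinner x x))\<close> and
  definiteness of \<open>cinner\<close> are inherited from \<^class>\<open>real_inner\<close>.  The complex inner product is
  linear in its first argument.
\<close>

class complex_hilbert_space = real_inner + complete_space +
  fixes scaleC :: "complex \<Rightarrow> 'a \<Rightarrow> 'a" (infixr \<open>*\<^sub>C\<close> 75)
    and cinner :: "'a \<Rightarrow> 'a \<Rightarrow> complex"
  assumes scaleC_add_right: "c *\<^sub>C (x + y) = c *\<^sub>C x + c *\<^sub>C y"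
    and scaleC_add_left: "(c + d) *\<^sub>C x = c *\<^sub>C x + d *\<^sub>C x"
    and scaleC_scaleC: "c *\<^sub>C d *\<^sub>C x = (c * d) *\<^sub>C x"
    and scaleC_one: "1 *\<^sub>C x = x"
    and scaleR_scaleC: "r *\<^sub>R x = complex_of_real r *\<^sub>C x"
    and cinner_commute: "cinner x y = cnj (cinner y x)"
    and cinner_add_left: "cinner (x + y) z = cinner x z + cinner y z"
    and cinner_scaleC_left: "cinner (c *\<^sub>C x) y = c * cinner x y"
    and inner_eq_Re_cinner: "inner x y = Re (cinner x y)"

text \<open>
  The algebra \<open>\<B>(\<H>)\<close>: the library type \<open>'h \<Rightarrow>\<^sub>L 'h\<close> consists of the bounded real-linear maps, among
  which the complex-linear ones are singled out.
\<close>

definition bounded_ops :: "('h::complex_hilbert_space \<Rightarrow>\<^sub>L 'h) set" where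
  "bounded_ops = {T. \<forall>c x. blinfun_apply T (c *\<^sub>C x) = c *\<^sub>C blinfun_apply T x}"

definition cadjoint ::
    "('h::complex_hilbert_space \<Rightarrow>\<^sub>L 'h) \<Rightarrow> ('h \<Rightarrow>\<^sub>L 'h)" where
  "cadjoint T = (THE S. S \<in> bounded_ops \<and>
     (\<forall>x y. cinner (blinfun_apply T x) y = cinner x (blinfun_apply S y)))"

definition inverse_ops ::
    "('h::complex_hilbert_space \<Rightarrow>\<^sub>L 'h) \<Rightarrow> ('h \<Rightarrow>\<^sub>L 'h) \<Rightarrow> bool" where
  "inverse_ops L L' \<longleftrightarrow> L \<in> bounded_ops \<and> L' \<in> bounded_ops \<and>
     L o\<^sub>L L' = id_blinfun \<and> L' o\<^sub>L L = id_blinfun"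


subsection \<open>Representations\<close>

definition continuous_representation ::
    "('g::{topological_group_add,t2_space} \<Rightarrow> ('h::complex_hilbert_space \<Rightarrow>\<^sub>L 'h)) \<Rightarrow> bool" where
  "continuous_representation \<pi> \<longleftrightarrow>
     (\<forall>g. \<pi> g \<in> bounded_ops) \<and>
     \<pi> 0 = id_blinfun \<and>
     (\<forall>g h. \<pi> (g + h) = \<pi> g o\<^sub>L \<pi> h) \<and>
     continuous_map euclidean strong_operator_topology \<pi>"

definition unitary_representation ::
    "('g::{topological_group_add,t2_space} \<Rightarrow> ('h::complex_hilbert_space \<Rightarrow>\<^sub>L 'h)) \<Rightarrow> bool" where
  "unitary_representation \<pi> \<longleftrightarrow>
     continuous_representation \<pi> \<and>
     (\<forall>g. cadjoint (\<pi> g) o\<^sub>L \<pi> g = id_blinfun \<and> \<pi> g o\<^sub>L cadjoint (\<pi> g) = id_blinfun)"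

definition unitarizable ::
    "('g::{topological_group_add,t2_space} \<Rightarrow> ('h::complex_hilbert_space \<Rightarrow>\<^sub>L 'h)) \<Rightarrow> bool" where
  "unitarizable \<pi> \<longleftrightarrow>
     (\<exists>L L'. inverse_ops L L' \<and> unitary_representation (\<lambda>g. L' o\<^sub>L \<pi> g o\<^sub>L L))"

end

theory Submission
  imports Defs
begin

text \<open>
  Writing \<open>g = u v\<close> gives \<open>\<langle>\<pi>(g)x, y\<rangle> = \<langle>\<pi>(v)x, \<pi>(u)\<^sup>*y\<rangle>\<close>.  For \<open>g \<in> F\<^sub>N\<close> and \<open>v \<in> F\<^sub>N\<close> the factor
  \<open>u = g v\<inverse>\<close> lies in \<open>F\<^sub>p\<^sub>N\<close>, whose measure is at most \<open>K |F\<^sub>N|\<close>, so by Chebyshev's inequality the two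
  mean bounds leave some \<open>v\<close> for which both \<open>\<pi>(v)x\<close> and \<open>\<pi>(u)\<^sup>*y\<close> are controlled.  Hence \<open>\<pi>\<close> is uniformly
  bounded.  This needs that inversion preserves the measure, which follows from Fubini's theorem
  by a short uniqueness argument for Haar measure.  A uniformly bounded representation of an
  amenable group is unitarizable by the Day--Dixmier argument: averaging
  \<open>\<langle>\<pi>(g\<inverse>)x, \<pi>(g\<inverse>)y\<rangle>\<close> with an invariant mean gives an equivalent invariant inner product
  \<open>\<langle>A x, y\<rangle>\<close>, and conjugation by the square root of \<open>A\<close> makes \<open>\<pi>\<close> unitary.
\<close>

subsection \<open>Inversion invariance of Haar measure\<close>

text \<open>Compactness leaves finitely many open boxes inside \<open>U\<close> that cover
  \<open>S\<close>. Their union is a finite union of measurable rectangles, although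
  \<open>S\<close> and \<open>U\<close> themselves need not be measurable for the product of the
  Borel algebras.\<close>

lemma compact_subset_pair_measurable_subset:
  fixes S U :: "('a::topological_space \<times> 'b::topological_space) set"
  assumes "compact S" "open U" "S \<subseteq> U"
  shows "\<exists>R \<in> sets (borel \<Otimes>\<^sub>M borel). S \<subseteq> R \<and> R \<subseteq> U"
proof -
  have "\<exists>A B. open A \<and> open B \<and> z \<in> A \<times> B \<and> A \<times> B \<subseteq> U" if "z \<in> S" for z
    using \<open>open U\<close>[unfolded open_prod_def] subsetD[OF assms(3) that] by (rule bspec)
  then obtain A B where AB: "\<And>z. z \<in> S \<Longrightarrow> open (A z) \<and> open (B z) \<and> z \<in> A z \<times> B z \<and> A z \<times> B z \<subseteq> U"
    by metis
  have op: "open (A z \<times> B z)" if "z \<in> S" for z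
    using AB[OF that] by (simp add: open_Times)
  have "S \<subseteq> (\<Union>z\<in>S. A z \<times> B z)"
    using AB by (auto intro!: UN_I)
  then obtain D where D: "D \<subseteq> S" "finite D" "S \<subseteq> (\<Union>z\<in>D. A z \<times> B z)"
    using compactE_image[OF \<open>compact S\<close>, of S "\<lambda>z. A z \<times> B z"] op by auto
  show ?thesis
  proof (intro bexI conjI)
    show "(\<Union>z\<in>D. A z \<times> B z) \<in> sets (borel \<Otimes>\<^sub>M borel)"
      using AB D by (intro sets.finite_UN pair_measureI) auto
    show "(\<Union>z\<in>D. A z \<times> B z) \<subseteq> U"
      using AB D(1) by (intro UN_least) auto
  qed (fact D(3))
qed

text \<open>
  Without second countability the Borel sets of a product need not lie in the product of the
  Borel \<open>\<sigma>\<close>-algebras; \<open>\<sigma>\<close>-compactness rescues the open sets of the form \<open>{z. a < k z}\<close>.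
\<close>

lemma continuous_imp_pair_borel_measurable:
  fixes k :: "'a::t2_space \<times> 'b::t2_space \<Rightarrow> real"
  assumes k: "continuous_on UNIV k"
    and K: "\<And>n::nat. compact (K n :: 'a set)" "(\<Union>n. K n) = UNIV"
    and L: "\<And>n::nat. compact (L n :: 'b set)" "(\<Union>n. L n) = UNIV"
  shows "k \<in> borel_measurable (borel \<Otimes>\<^sub>M borel)"
proof (rule borel_measurableI_greater)
  fix a :: real
  define U where "U = {z. a < k z}"
  have "open U"
    unfolding U_def using k by (intro open_Collect_less) auto
  \<comment> \<open>The margin \<open>1 / real (Suc n)\<close> turns the strict inequality defining
    \<open>U\<close> into a closed condition. Each piece is therefore compact and stays inside
    \<open>U\<close>, and the pieces exhaust \<open>U\<close>.\<close>
  define S where "S i j n = (K i \<times> L j) \<inter> {z. a + 1 / real (Suc n) \<le> k z}" for i j n :: nat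
  have "compact (S i j n)" for i j n
    unfolding S_def using k K L
    by (intro compact_Int_closed compact_Times closed_Collect_le) auto
  moreover have "S i j n \<subseteq> U" for i j n
  proof
    fix z assume "z \<in> S i j n"
    then have "a + 1 / real (Suc n) \<le> k z"
      by (simp add: S_def)
    moreover have "0 < 1 / real (Suc n)"
      by simp
    ultimately show "z \<in> U"
      unfolding U_def mem_Collect_eq by linarith
  qed
  ultimately have "\<forall>i j n. \<exists>R \<in> sets (borel \<Otimes>\<^sub>M borel). S i j n \<subseteq> R \<and> R \<subseteq> U"
    using compact_subset_pair_measurable_subset[OF _ \<open>open U\<close>] by simp
  then obtain R where R: "\<And>i j n. R i j n \<in> sets (borel \<Otimes>\<^sub>M borel)"
    "\<And>i j n. S i j n \<subseteq> R i j n" "\<And>i j n. R i j n \<subseteq> U"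
    by metis
  have "U \<subseteq> (\<Union>i j n. R i j n)"
  proof
    fix z assume z: "z \<in> U"
    obtain i j where ij: "fst z \<in> K i" "snd z \<in> L j"
      using K(2) L(2) by (metis UNIV_I UN_E)
    obtain n where "1 / real (Suc n) < k z - a"
      using reals_Archimedean[of "k z - a"] z by (auto simp: U_def inverse_eq_divide)
    then have "a + 1 / real (Suc n) \<le> k z"
      by linarith
    with ij have "z \<in> S i j n"
      unfolding S_def by (simp add: mem_Times_iff)
    then show "z \<in> (\<Union>i j n. R i j n)"
      using R(2)[of i j n] by auto
  qed
  then have "U = (\<Union>i j n. R i j n)"
    by (intro equalityI UN_least R(3))
  also have "\<dots> \<in> sets (borel \<Otimes>\<^sub>M borel)"
    using R(1) by (intro sets.countable_UN image_subsetI) simp_all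
  finally show "{x \<in> space (borel \<Otimes>\<^sub>M borel). a < k x} \<in> sets (borel \<Otimes>\<^sub>M borel)"
    by (simp add: U_def space_pair_measure)
qed

section \<open>Integration against a two-sided invariant measure\<close>

locale unimodular_group =
  fixes m :: "'g::{topological_group_add,t2_space} measure"
  assumes sigma_compact: "sigma_compact_space (euclidean :: 'g topology)"
    and locally_compact: "locally_compact_space (euclidean :: 'g topology)"
    and haar: "right_haar_measure m"
    and unimodular: "unimodular m"
begin

lemma sets_m [simp, measurable_cong]: "sets m = sets borel"
  and emeasure_compact: "compact A \<Longrightarrow> emeasure m A < \<infinity>"
  and emeasure_outer: "A \<in> sets borel \<Longrightarrow> emeasure m A = (INF U\<in>{U. open U \<and> A \<subseteq> U}. emeasure m U)"
  and emeasure_right: "A \<in> sets borel \<Longrightarrow> emeasure m ((\<lambda>a. a + s) ` A) = emeasure m A"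
  using haar by (auto simp: right_haar_measure_def radon_measure_def)

lemma emeasure_left: "A \<in> sets borel \<Longrightarrow> emeasure m ((\<lambda>a. s + a) ` A) = emeasure m A"
  using unimodular by (auto simp: unimodular_def)

lemma space_m [simp]: "space m = UNIV"
  using sets_eq_imp_space_eq[OF sets_m] by simp

lemma compact_exhaustion: "\<exists>Q :: nat \<Rightarrow> 'g set. (\<forall>n. compact (Q n)) \<and> (\<Union>n. Q n) = UNIV"
  using sigma_compact by (simp add: sigma_compact_space_def)

lemma sigma_finite: "sigma_finite_measure m"
proof -
  obtain Q :: "nat \<Rightarrow> 'g set" where Q: "\<And>n. compact (Q n)" "(\<Union>n. Q n) = UNIV"
    using compact_exhaustion by auto
  show ?thesis
  proof
    show "\<exists>A. countable A \<and> A \<subseteq> sets m \<and> \<Union> A = space m \<and> (\<forall>a\<in>A. emeasure m a \<noteq> \<infinity>)"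
      using Q less_imp_neq[OF emeasure_compact[OF Q(1)]]
      by (intro exI[of _ "range Q"]) (auto intro: borel_compact)
  qed
qed

lemma measurable_translations:
  "(\<lambda>x. x + s) \<in> borel \<rightarrow>\<^sub>M borel" "(\<lambda>x. s + x) \<in> borel \<rightarrow>\<^sub>M borel" for s :: 'g
  by (auto intro!: borel_measurable_continuous_onI continuous_intros)

lemma nn_integral_right:
  assumes "f \<in> borel_measurable borel"
  shows "(\<integral>\<^sup>+ x. f (x + s) \<partial>m) = (\<integral>\<^sup>+ x. f x \<partial>m)"
proof -
  have meas: "(\<lambda>x. x + s) \<in> m \<rightarrow>\<^sub>M borel"
    using measurable_translations by simp
  have "emeasure (distr m borel (\<lambda>x. x + s)) A = emeasure m A" if "A \<in> sets borel" for A
  proof -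
    have "(\<lambda>x. x + s) -` A = (\<lambda>a. a + - s) ` A"
      by (force simp: image_iff add.assoc)
    then show ?thesis
      using that emeasure_right[of A "-s"] by (simp add: emeasure_distr[OF meas])
  qed
  then have "distr m borel (\<lambda>x. x + s) = m"
    by (intro measure_eqI) auto
  then show ?thesis
    using nn_integral_distr[OF meas, of f] assms by simp
qed

lemma nn_integral_left:
  assumes "f \<in> borel_measurable borel"
  shows "(\<integral>\<^sup>+ x. f (s + x) \<partial>m) = (\<integral>\<^sup>+ x. f x \<partial>m)"
proof -
  have meas: "(\<lambda>x. s + x) \<in> m \<rightarrow>\<^sub>M borel"
    using measurable_translations by simp
  have "emeasure (distr m borel (\<lambda>x. s + x)) A = emeasure m A" if "A \<in> sets borel" for A
  proof -
    have "(\<lambda>x. s + x) -` A = (\<lambda>a. - s + a) ` A"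
      by (force simp: image_iff add.assoc[symmetric])
    then show ?thesis
      using that emeasure_left[of A "-s"] by (simp add: emeasure_distr[OF meas])
  qed
  then have "distr m borel (\<lambda>x. s + x) = m"
    by (intro measure_eqI) auto
  then show ?thesis
    using nn_integral_distr[OF meas, of f] assms by simp
qed

text \<open>
  Replacing \<open>x\<close> by \<open>x - y\<close>, then \<open>y\<close> by \<open>y + x\<close>, then \<open>x\<close> by \<open>y + x\<close> moves the inversion from
  one factor to the other: \<open>f x g (-y)\<close>, \<open>f (x - y) g (-y)\<close>, \<open>f (-y) g (-x - y)\<close>,
  \<open>f (-y) g (-x)\<close>.  Continuity of \<open>f\<close> and \<open>g\<close> makes the intermediate kernels measurable.
\<close>

lemma nn_integral_uminus_cross:
  fixes f g :: "'g \<Rightarrow> real"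
  assumes f: "continuous_on UNIV f" "\<And>x. 0 \<le> f x" and g: "continuous_on UNIV g" "\<And>x. 0 \<le> g x"
  shows "(\<integral>\<^sup>+ x. f x \<partial>m) * (\<integral>\<^sup>+ x. g (- x) \<partial>m) = (\<integral>\<^sup>+ x. f (- x) \<partial>m) * (\<integral>\<^sup>+ x. g (- x) \<partial>m)"
proof -
  obtain Q :: "nat \<Rightarrow> 'g set" where Q: "\<And>n. compact (Q n)" "(\<Union>n. Q n) = UNIV"
    using compact_exhaustion by auto
  interpret pair_sigma_finite m m
    using sigma_finite by (simp add: pair_sigma_finite_def)
  have cont: "continuous_on UNIV (\<lambda>x. h (c x))"
    if "continuous_on UNIV h" "continuous_on UNIV c" for h :: "'g \<Rightarrow> real" and c :: "'c::topological_space \<Rightarrow> 'g"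
    using continuous_on_compose2[OF that] by auto
  have meas: "(\<lambda>x. h (c x)) \<in> borel_measurable borel"
    if "continuous_on UNIV h" "continuous_on UNIV c" for h :: "'g \<Rightarrow> real" and c :: "'g \<Rightarrow> 'g"
    using cont[OF that] by (rule borel_measurable_continuous_onI)
  have fg [measurable]: "f \<in> borel_measurable borel" "g \<in> borel_measurable borel"
    using f g by (auto intro: borel_measurable_continuous_onI)
  have fm [measurable]: "(\<lambda>x. f (- x)) \<in> borel_measurable borel"
     "(\<lambda>x. g (- x)) \<in> borel_measurable borel"
    using f g by (auto intro!: meas continuous_intros)
  have k: "(\<lambda>z. h1 (c z) * h2 (d z)) \<in> borel_measurable (m \<Otimes>\<^sub>M m)"
    if "continuous_on UNIV h1" "continuous_on UNIV h2" "continuous_on UNIV c" "continuous_on UNIV d"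
    for h1 h2 :: "'g \<Rightarrow> real" and c d :: "'g \<times> 'g \<Rightarrow> 'g"
    using continuous_imp_pair_borel_measurable[OF continuous_on_mult[OF cont[OF that(1,3)] cont[OF that(2,4)]] Q Q]
    by (simp add: measurable_cong_sets[OF sets_pair_measure_cong[OF sets_m sets_m]])
  have c: "continuous_on UNIV (\<lambda>z::'g \<times> 'g. fst z - snd z)" "continuous_on UNIV (\<lambda>z::'g \<times> 'g. - snd z)"
    "continuous_on UNIV (\<lambda>z::'g \<times> 'g. - fst z - snd z)"
    by (intro continuous_intros)+
  have k1: "(\<lambda>(x, y). ennreal (f (x - y) * g (- y))) \<in> borel_measurable (m \<Otimes>\<^sub>M m)"
    using measurable_compose[OF k[OF f(1) g(1) c(1,2)] measurable_ennreal] by (simp add: case_prod_unfold)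
  have k2: "(\<lambda>(x, y). ennreal (f (- y) * g (- x - y))) \<in> borel_measurable (m \<Otimes>\<^sub>M m)"
    using measurable_compose[OF k[OF f(1) g(1) c(2,3)] measurable_ennreal] by (simp add: case_prod_unfold)
  have "(\<integral>\<^sup>+ x. f x \<partial>m) * (\<integral>\<^sup>+ x. g (- x) \<partial>m) = (\<integral>\<^sup>+ y. (\<integral>\<^sup>+ x. f x \<partial>m) * g (- y) \<partial>m)"
    by (subst nn_integral_cmult) auto
  also have "\<dots> = (\<integral>\<^sup>+ y. (\<integral>\<^sup>+ x. ennreal (f (x - y) * g (- y)) \<partial>m) \<partial>m)"
  proof (rule nn_integral_cong)
    fix y
    have [measurable]: "(\<lambda>x. f (x - y)) \<in> borel_measurable borel"
      using f by (auto intro!: meas continuous_intros)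
    show "(\<integral>\<^sup>+ x. f x \<partial>m) * ennreal (g (- y)) = (\<integral>\<^sup>+ x. ennreal (f (x - y) * g (- y)) \<partial>m)"
      using f g nn_integral_right[of "\<lambda>x. ennreal (f x)" "-y"]
      by (simp add: ennreal_mult nn_integral_multc)
  qed
  also have "\<dots> = (\<integral>\<^sup>+ x. (\<integral>\<^sup>+ y. ennreal (f (x - y) * g (- y)) \<partial>m) \<partial>m)"
    using Fubini'[OF k1] .
  also have "\<dots> = (\<integral>\<^sup>+ x. (\<integral>\<^sup>+ y. ennreal (f (- y) * g (- x - y)) \<partial>m) \<partial>m)"
  proof (rule nn_integral_cong)
    fix x
    have [measurable]: "(\<lambda>y. f (x - y)) \<in> borel_measurable borel"
      using f by (auto intro!: meas continuous_intros)
    have "(\<lambda>y. ennreal (f (x - y) * g (- y))) \<in> borel_measurable borel"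
      by measurable
    from nn_integral_right[OF this, of x]
    show "(\<integral>\<^sup>+ y. ennreal (f (x - y) * g (- y)) \<partial>m) = (\<integral>\<^sup>+ y. ennreal (f (- y) * g (- x - y)) \<partial>m)"
      by (simp add: diff_conv_add_uminus minus_add add.assoc[symmetric] del: add_uminus_conv_diff)
  qed
  also have "\<dots> = (\<integral>\<^sup>+ y. (\<integral>\<^sup>+ x. ennreal (f (- y) * g (- x - y)) \<partial>m) \<partial>m)"
    using Fubini'[OF k2] by simp
  also have "\<dots> = (\<integral>\<^sup>+ y. f (- y) * (\<integral>\<^sup>+ x. g (- x) \<partial>m) \<partial>m)"
  proof (rule nn_integral_cong)
    fix y
    have [measurable]: "(\<lambda>x. g (- x - y)) \<in> borel_measurable borel"
      using g by (auto intro!: meas continuous_intros)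
    \<comment> \<open>Unimodularity enters here: \<open>- x - y\<close> is \<open>- (y + x)\<close>,
      so the shift is a left translation, while the earlier substitutions are right
      translations.\<close>
    have "(\<integral>\<^sup>+ x. g (- x - y) \<partial>m) = (\<integral>\<^sup>+ x. g (- x) \<partial>m)"
      using nn_integral_left[of "\<lambda>x. ennreal (g (- x))" y]
      by (simp add: diff_conv_add_uminus minus_add del: add_uminus_conv_diff)
    then show "(\<integral>\<^sup>+ x. ennreal (f (- y) * g (- x - y)) \<partial>m) = f (- y) * (\<integral>\<^sup>+ x. g (- x) \<partial>m)"
      using f g by (simp add: ennreal_mult nn_integral_cmult)
  qed
  also have "\<dots> = (\<integral>\<^sup>+ x. f (- x) \<partial>m) * (\<integral>\<^sup>+ x. g (- x) \<partial>m)"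
    by (subst nn_integral_multc) auto
  finally show ?thesis .
qed

text \<open>A locally compact Hausdorff space is completely regular, so a continuous function
  separates the compact \<open>A\<close> from the closed complement of \<open>U\<close>. Such
  functions replace indicators because \<open>nn_integral_uminus_cross\<close> asks for continuous
  integrands.\<close>

lemma Urysohn_indicator:
  assumes "compact A" "open U" "A \<subseteq> U"
  obtains f :: "'g \<Rightarrow> real" where "continuous_on UNIV f" "\<And>x. indicator A x \<le> f x" "\<And>x. f x \<le> indicator U x"
proof -
  have "Hausdorff_space (euclidean :: 'g topology)"
    using hausdorff by (auto simp: Hausdorff_space_def disjnt_def)
  then have "completely_regular_space (euclidean :: 'g topology)"
    using locally_compact by (intro locally_compact_regular_imp_completely_regular_space disjI1)
  then obtain f where f: "continuous_map euclidean (subtopology euclidean {0..1::real}) f"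
      "f ` (- U) \<subseteq> {0}" "f ` A \<subseteq> {1}"
    by (rule Urysohn_completely_regular_compact_closed[of 0 "1::real" euclidean A "- U", rotated])
      (use assms in \<open>auto simp: disjnt_def\<close>)
  show ?thesis
  proof (rule that)
    show "continuous_on UNIV f"
      using f(1) by (simp add: continuous_map_in_subtopology)
    have "0 \<le> f x" "f x \<le> 1" for x
      using f(1) by (auto simp: continuous_map_in_subtopology Pi_iff)
    then show "indicator A x \<le> f x" "f x \<le> indicator U x" for x
      using f(2,3) assms by (auto simp: indicator_def image_subset_iff)
  qed
qed

lemma compact_open_superset:
  assumes "compact A" "emeasure m A < c"
  obtains U where "open U" "A \<subseteq> U" "emeasure m U < c"
  using assms emeasure_outer[OF borel_compact[OF assms(1)]] by (auto simp: INF_less_iff)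

text \<open>In \<open>nn_integral_uminus_cross\<close>, take \<open>f\<close> close to the indicator
  of \<open>A\<close> and \<open>g\<close> close to that of \<open>S\<close>. The symmetry and
  positive measure of \<open>S\<close> make the integral of \<open>g (- x)\<close> positive and
  finite, so it cancels and \<open>f\<close> has the same integral as its reflection. Outer
  regularity then compares with \<open>A\<close>.\<close>

lemma emeasure_uminus_le:
  assumes A: "compact A" and S: "compact S" "uminus ` S = S" "0 < emeasure m S"
  shows "emeasure m (uminus ` A) \<le> emeasure m A"
proof (rule dense_ge)
  fix c assume "emeasure m A < c"
  then obtain U where U: "open U" "A \<subseteq> U" "emeasure m U < c"
    using compact_open_superset[OF A] by blast
  obtain f :: "'g \<Rightarrow> real" where f: "continuous_on UNIV f" "\<And>x. indicator A x \<le> f x" "\<And>x. f x \<le> indicator U x"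
    using Urysohn_indicator[OF A U(1,2)] by blast
  have fA: "1 \<le> f x" if "x \<in> A" for x
    using f(2)[of x] that by simp
  obtain W where W: "open W" "S \<subseteq> W" "emeasure m W < \<infinity>"
    using compact_open_superset[OF S(1) emeasure_compact[OF S(1)]] .
  \<comment> \<open>\<open>g\<close> is supported in the reflection of \<open>W\<close>, so that
    \<open>g (- x)\<close> is dominated by the indicator of \<open>W\<close>, which has finite
    measure. Symmetry of \<open>S\<close> places it inside this reflection.\<close>
  have "open (uminus -` W)"
    using W(1) by (auto intro!: open_vimage continuous_intros)
  moreover have "S \<subseteq> uminus -` W"
    using W(2) S(2) by blast
  ultimately obtain g :: "'g \<Rightarrow> real" where g: "continuous_on UNIV g" "\<And>x. indicator S x \<le> g x"
      "\<And>x. g x \<le> indicator (uminus -` W) x"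
    using Urysohn_indicator[OF S(1)] by blast
  have nonneg: "0 \<le> f x" "0 \<le> g x" for x
    using order_trans[OF _ f(2)] order_trans[OF _ g(2)] by simp_all
  have "compact (uminus ` A)"
    using A by (intro compact_continuous_image continuous_intros)
  then have sets: "uminus ` A \<in> sets borel" "S \<in> sets borel" "W \<in> sets borel" "U \<in> sets borel"
    using S W U by (auto intro: borel_compact)
  have "(\<integral>\<^sup>+ x. g (- x) \<partial>m) \<le> (\<integral>\<^sup>+ x. indicator W x \<partial>m)"
    using g(3)[of "- x" for x]
    by (intro nn_integral_mono) (simp add: ennreal_leI indicator_vimage flip: ennreal_indicator)
  then have finite: "(\<integral>\<^sup>+ x. g (- x) \<partial>m) \<noteq> \<infinity>"
    using W sets by (auto simp: top_unique)
  have "x \<in> S \<Longrightarrow> - x \<in> S" for x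
    using S(2) by blast
  then have "(\<integral>\<^sup>+ x. indicator S x \<partial>m) \<le> (\<integral>\<^sup>+ x. g (- x) \<partial>m)"
    using order_trans[OF _ g(2)[of "- x" for x]]
    by (intro nn_integral_mono) (auto simp: indicator_def intro: ennreal_leI)
  then have pos: "(\<integral>\<^sup>+ x. g (- x) \<partial>m) \<noteq> 0"
    using S(3) sets by auto
  have "emeasure m (uminus ` A) = (\<integral>\<^sup>+ x. indicator (uminus ` A) x \<partial>m)"
    using sets by simp
  also have "\<dots> \<le> (\<integral>\<^sup>+ x. f (- x) \<partial>m)"
    using fA by (intro nn_integral_mono) (auto simp: indicator_def)
  also have "\<dots> = (\<integral>\<^sup>+ x. f x \<partial>m)"
    using nn_integral_uminus_cross[OF f(1) nonneg(1) g(1) nonneg(2)] finite pos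
    by (simp add: ennreal_mult_cancel_left mult.commute[of _ "\<integral>\<^sup>+ x. g (- x) \<partial>m"])
  also have "\<dots> \<le> (\<integral>\<^sup>+ x. indicator U x \<partial>m)"
    using f(3) by (intro nn_integral_mono) (simp add: ennreal_leI flip: ennreal_indicator)
  also have "\<dots> \<le> c"
    using sets U(3) by simp
  finally show "emeasure m (uminus ` A) \<le> c" .
qed

end

subsection \<open>Operators on Hilbert spaces\<close>

instance complex_hilbert_space \<subseteq> banach ..

text \<open>The representing vector minimizes \<open>\<parallel>x\<parallel>\<^sup>2 - 2 f x\<close>.\<close>

lemma Riesz_representation:
  fixes f :: "'a::{real_inner, complete_space} \<Rightarrow> real"
  assumes "bounded_linear f"
  shows "\<exists>x. \<forall>y. inner x y = f y"
proof -
  interpret f: bounded_linear f by fact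
  obtain B where B: "\<And>x. \<bar>f x\<bar> \<le> norm x * B"
    using f.bounded by auto
  define J where "J x = inner x x - 2 * f x" for x
  have "- B\<^sup>2 \<le> J x" for x
  proof -
    have "0 \<le> (norm x - B)\<^sup>2" by simp
    moreover have "f x \<le> norm x * B" using B[of x] by simp
    ultimately show ?thesis
      by (simp add: J_def power2_norm_eq_inner[symmetric] power2_eq_square algebra_simps)
  qed
  then have bdd: "bdd_below (range J)" by (auto intro: bdd_belowI2[of _ "- B\<^sup>2"])
  define I where "I = (INF x. J x)"
  have I_le: "I \<le> J x" for x
    unfolding I_def by (rule cINF_lower[OF bdd]) simp
  have "\<exists>x. J x < I + 1 / real (Suc n)" for n
  proof -
    have "I < I + 1 / real (Suc n)" by simp
    then show ?thesis
      unfolding I_def using cINF_less_iff[OF _ bdd, of "(INF x. J x) + 1 / real (Suc n)"] by auto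
  qed
  then obtain u where u: "\<And>n. J (u n) < I + 1 / real (Suc n)" by metis
  \<comment> \<open>By this parallelogram identity, two near-minimizers of \<open>J\<close> must be
    close: their midpoint cannot fall below the infimum \<open>I\<close>.\<close>
  have mid: "J ((1/2) *\<^sub>R (x + y)) = (J x + J y) / 2 - (norm (x - y))\<^sup>2 / 4" for x y
    by (simp add: J_def power2_norm_eq_inner f.add f.scaleR inner_simps inner_commute field_simps)
  have close: "(norm (u i - u j))\<^sup>2 \<le> 4 / real (Suc N)" if "i \<ge> N" "j \<ge> N" for i j N
  proof -
    have "1 / real (Suc i) \<le> 1 / real (Suc N)" "1 / real (Suc j) \<le> 1 / real (Suc N)"
      using that by (auto simp: field_simps)
    moreover have "I \<le> (J (u i) + J (u j)) / 2 - (norm (u i - u j))\<^sup>2 / 4"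
      using I_le mid by metis
    moreover have "4 / real (Suc N) = 4 * (1 / real (Suc N))" by simp
    ultimately show ?thesis using u[of i] u[of j] by argo
  qed
  have "Cauchy u"
  proof (rule metric_CauchyI)
    fix e :: real assume e: "0 < e"
    obtain N where "inverse (real (Suc N)) < e\<^sup>2 / 4"
      using reals_Archimedean[of "e\<^sup>2 / 4"] e by auto
    then have N: "4 / real (Suc N) < e\<^sup>2" by (simp add: inverse_eq_divide field_simps)
    show "\<exists>M. \<forall>i\<ge>M. \<forall>j\<ge>M. dist (u i) (u j) < e"
    proof (intro exI allI impI)
      fix i j assume "N \<le> i" "N \<le> j"
      then have "(norm (u i - u j))\<^sup>2 < e\<^sup>2"
        using close[of N i j] N by simp
      then show "dist (u i) (u j) < e"
        using e by (simp add: dist_norm power2_less_imp_less)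
    qed
  qed
  then obtain x where x: "u \<longlonglongrightarrow> x"
    by (auto simp: Cauchy_convergent_iff convergent_def)
  have "(\<lambda>n. J (u n)) \<longlonglongrightarrow> J x"
    unfolding J_def by (intro tendsto_intros x f.tendsto)
  moreover have "(\<lambda>n. I + 1 / real (Suc n)) \<longlonglongrightarrow> I + 0"
    by (intro tendsto_intros LIMSEQ_Suc[OF lim_1_over_n])
  ultimately have "J x \<le> I + 0"
    using u by (intro LIMSEQ_le) (auto intro: less_imp_le)
  then have minimal: "J x \<le> J z" for z
    using I_le[of z] by simp
  have "inner x y = f y" for y
  proof (rule ccontr)
    define d where "d = inner x y - f y"
    assume "inner x y \<noteq> f y"
    then have d: "d \<noteq> 0" "y \<noteq> 0" by (auto simp: d_def f.zero)
    then have y: "inner y y > 0" by simp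
    have "J (x + t *\<^sub>R y) = J x + (2 * t * d + t\<^sup>2 * inner y y)" for t
      by (simp add: J_def d_def f.add f.scaleR inner_simps inner_commute power2_eq_square algebra_simps)
    then have "0 \<le> 2 * t * d + t\<^sup>2 * inner y y" for t
      using minimal by (metis le_add_same_cancel1)
    \<comment> \<open>This \<open>t\<close> minimizes the quadratic, and its value there is negative
      unless \<open>d = 0\<close>.\<close>
    from this[of "- d / inner y y"] have "0 \<le> - (d\<^sup>2 / inner y y)"
      using y by (simp add: power2_eq_square field_simps)
    moreover have "d\<^sup>2 / inner y y > 0" using d y by simp
    ultimately show False by linarith
  qed
  then show ?thesis by blast
qed

text \<open>Each \<open>b x\<close> has a representing vector; its uniqueness makes it linear in
  \<open>x\<close>, and testing \<open>b x\<close> against \<open>A x\<close> bounds it.\<close>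

lemma Riesz_bilinear:
  fixes b :: "'a::{real_inner, complete_space} \<Rightarrow> 'a \<Rightarrow> real"
  assumes "bounded_bilinear b"
  shows "\<exists>A :: 'a \<Rightarrow>\<^sub>L 'a. \<forall>x y. inner (A x) y = b x y"
proof -
  interpret b: bounded_bilinear b by fact
  have "\<forall>x. \<exists>z. \<forall>y. inner z y = b x y"
    using Riesz_representation[OF b.bounded_linear_right] by blast
  then obtain A where A: "\<And>x y. inner (A x) y = b x y" by metis
  obtain K where K: "K \<ge> 0" "\<And>x y. \<bar>b x y\<bar> \<le> norm x * norm y * K"
    using b.nonneg_bounded by auto
  have "bounded_linear A"
  proof (rule bounded_linear_intro[of _ K])
    show "A (x + y) = A x + A y" for x y
      by (rule vector_eq_rdot[THEN iffD1]) (simp add: inner_add_left A b.add_left)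
    show "A (r *\<^sub>R x) = r *\<^sub>R A x" for r x
      by (rule vector_eq_rdot[THEN iffD1]) (simp add: A b.scaleR_left)
    show "norm (A x) \<le> norm x * K" for x
    proof -
      have "norm (A x) * norm (A x) \<le> norm (A x) * (norm x * K)"
        using K(2)[of x "A x"] by (simp add: A[symmetric] norm_eq_sqrt_inner ac_simps)
      then show ?thesis
        using K(1) by (cases "A x = 0") (auto simp: mult_le_cancel_left_pos)
    qed
  qed
  then show ?thesis
    using A by (intro exI[of _ "Blinfun A"]) (simp add: bounded_linear_Blinfun_apply)
qed

text \<open>The Banach--Steinhaus theorem. By Baire's theorem some closed set \<open>E n\<close>
  contains a ball \<open>cball x r\<close>; subtracting the values at \<open>x\<close> from those at
  \<open>x + w\<close> bounds every \<open>T i\<close> on vectors \<open>w\<close> of norm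
  \<open>r\<close>.\<close>

lemma uniform_boundedness:
  fixes T :: "'i \<Rightarrow> 'a::banach \<Rightarrow>\<^sub>L 'b::real_normed_vector"
  assumes "\<And>x. \<exists>B. \<forall>i\<in>I. norm (T i x) \<le> B"
  shows "\<exists>B. \<forall>i\<in>I. norm (T i) \<le> B"
proof -
  define E where "E n = {x. \<forall>i\<in>I. norm (T i x) \<le> real n}" for n :: nat
  have "E n = (\<Inter>i\<in>I. {x. norm (T i x) \<le> real n})" for n
    by (auto simp: E_def)
  moreover have "closed {x. norm (T i x) \<le> real n}" for i n
    by (intro closed_Collect_le continuous_intros)
  ultimately have clos: "closed (E n)" for n
    by (simp add: closed_INT)
  have "x \<in> (\<Union>n. E n)" for x
  proof -
    obtain B where B: "\<forall>i\<in>I. norm (T i x) \<le> B" using assms by blast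
    obtain n :: nat where "B \<le> real n" using real_arch_simple by blast
    with B have "x \<in> E n" by (auto simp: E_def)
    then show ?thesis by blast
  qed
  then have cover: "(\<Union>n. E n) = UNIV" by blast
  have "\<exists>n. interior (E n) \<noteq> {}"
  proof (rule ccontr)
    assume "\<not> ?thesis"
    then have "Met_TC.mtopology interior_of \<Union>(range E) = ({} :: 'a set)"
      using clos by (intro Met_TC.metric_Baire_category_alt) (auto simp: complete_UNIV)
    then show False
      using cover by simp
  qed
  then obtain n x where "x \<in> interior (E n)" by blast
  then obtain r where r: "r > 0" "cball x r \<subseteq> E n"
    by (auto simp: mem_interior_cball)
  have "norm (T i) \<le> 2 * real n / r" if i: "i \<in> I" for i
  proof (rule norm_blinfun_bound)
    fix z
    show "norm (T i z) \<le> 2 * real n / r * norm z"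
    proof (cases "z = 0")
      case False
      define w where "w = (r / norm z) *\<^sub>R z"
      have w: "norm w = r" using False r by (simp add: w_def)
      then have "x + w \<in> E n" "x \<in> E n"
        using r by (auto simp: dist_norm subset_iff)
      then have "norm (T i (x + w)) \<le> n" "norm (T i x) \<le> n"
        using i by (auto simp: E_def)
      then have "norm (T i w) \<le> 2 * n"
        using norm_triangle_ineq4[of "T i (x + w)" "T i x"] by (simp add: blinfun.add_right)
      moreover have "T i w = (r / norm z) *\<^sub>R T i z"
        by (simp add: w_def blinfun.scaleR_right)
      ultimately show ?thesis
        using r False by (simp add: field_simps)
    qed (simp add: blinfun.zero_right)
  qed (use r in simp)
  then show ?thesis by blast
qed

text \<open>The real inner product suffices: for complex-linear operators,
  \<open>cinner_eqI_inner\<close> upgrades the identity to the complex inner product.\<close>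

definition selfadjoint :: "('a::real_inner \<Rightarrow>\<^sub>L 'a) \<Rightarrow> bool" where
  "selfadjoint T \<longleftrightarrow> (\<forall>x y. inner (T x) y = inner x (T y))"

text \<open>Polarization: rescale \<open>T x\<close> to a vector \<open>y\<close> with the norm of
  \<open>x\<close>. Then \<open>4 * inner (T x) y\<close> is the quadratic form at
  \<open>x + y\<close> minus that at \<open>x - y\<close>; the latter is dropped by positivity, and
  \<open>norm (x + y)\<close> is at most \<open>2 * norm x\<close>.\<close>

lemma norm_selfadjoint_le:
  assumes "selfadjoint T" "0 \<le> q" "\<And>x. 0 \<le> inner (T x) x" "\<And>x. inner (T x) x \<le> q * (norm x)\<^sup>2"
  shows "norm T \<le> q"
proof (rule norm_blinfun_bound[OF assms(2)])
  fix x
  show "norm (T x) \<le> q * norm x"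
  proof (cases "T x = 0 \<or> x = 0")
    case False
    define y where "y = (norm x / norm (T x)) *\<^sub>R T x"
    have y: "norm y = norm x" using False by (simp add: y_def)
    have sym: "inner (T y) x = inner (T x) y"
      using assms(1) by (simp add: selfadjoint_def inner_commute)
    have "4 * inner (T x) y = inner (T (x + y)) (x + y) - inner (T (x - y)) (x - y)"
      by (simp add: blinfun.bilinear_simps inner_simps sym)
    also have "\<dots> \<le> q * (norm (x + y))\<^sup>2"
      using assms(3)[of "x - y"] assms(4)[of "x + y"] by simp
    also have "\<dots> \<le> q * (2 * norm x)\<^sup>2"
      using norm_triangle_ineq[of x y] assms(2) y by (intro mult_left_mono power_mono) auto
    finally have "inner (T x) y \<le> q * (norm x)\<^sup>2" by (simp add: power2_eq_square)
    moreover have "inner (T x) y = norm x * norm (T x)"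
      using False by (simp add: y_def power2_norm_eq_inner[symmetric] power2_eq_square)
    ultimately show ?thesis using False by (simp add: power2_eq_square)
  qed (auto simp: assms(2) blinfun.zero_right)
qed

lemma blinfun_compose_id [simp]: "id_blinfun o\<^sub>L T = T" "T o\<^sub>L id_blinfun = T"
  by (auto intro: blinfun_eqI)

lemma blinfun_compose_assoc: "R o\<^sub>L (S o\<^sub>L T) = (R o\<^sub>L S) o\<^sub>L T"
  by (auto intro: blinfun_eqI)

lemma blinfun_apply_inverse: "S o\<^sub>L X = id_blinfun \<Longrightarrow> S (X x) = x"
  by (metis blinfun_apply_blinfun_compose blinfun_apply_id_blinfun)

text \<open>Left and right multiplication by \<open>Y\<close> are contractions, so
  \<open>X = I + Y X\<close> and \<open>X' = I + X' Y\<close> have solutions by Banach's fixed point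
  theorem. These are a right and a left inverse of \<open>I - Y\<close>, hence equal.\<close>

lemma inverse_one_minus:
  fixes Y :: "'a::banach \<Rightarrow>\<^sub>L 'a"
  assumes "norm Y < 1"
  shows "\<exists>X. (id_blinfun - Y) o\<^sub>L X = id_blinfun \<and> X o\<^sub>L (id_blinfun - Y) = id_blinfun"
proof -
  interpret c: bounded_bilinear "(o\<^sub>L) :: ('a \<Rightarrow>\<^sub>L 'a) \<Rightarrow> ('a \<Rightarrow>\<^sub>L 'a) \<Rightarrow> ('a \<Rightarrow>\<^sub>L 'a)"
    by (rule bounded_bilinear_blinfun_compose)
  have "\<exists>!X. id_blinfun + (Y o\<^sub>L X) = X"
  proof (rule banach_fix_type[of "norm Y"])
    show "\<forall>X Z. dist (id_blinfun + (Y o\<^sub>L X)) (id_blinfun + (Y o\<^sub>L Z)) \<le> norm Y * dist X Z"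
      by (simp add: dist_norm norm_blinfun_compose flip: c.diff_right)
  qed (use assms in auto)
  then obtain X where X: "id_blinfun + (Y o\<^sub>L X) = X" by blast
  have "\<exists>!X. id_blinfun + (X o\<^sub>L Y) = X"
  proof (rule banach_fix_type[of "norm Y"])
    show "\<forall>X Z. dist (id_blinfun + (X o\<^sub>L Y)) (id_blinfun + (Z o\<^sub>L Y)) \<le> norm Y * dist X Z"
      by (simp add: dist_norm mult.commute[of "norm Y"] norm_blinfun_compose flip: c.diff_left)
  qed (use assms in auto)
  then obtain X' where X': "id_blinfun + (X' o\<^sub>L Y) = X'" by blast
  have 1: "(id_blinfun - Y) o\<^sub>L X = id_blinfun"
  proof (rule blinfun_eqI)
    fix z
    show "((id_blinfun - Y) o\<^sub>L X) z = id_blinfun z"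
      using arg_cong[OF X, of "\<lambda>T. blinfun_apply T z"]
      by (simp add: blinfun.bilinear_simps algebra_simps)
  qed
  have 2: "X' o\<^sub>L (id_blinfun - Y) = id_blinfun"
  proof (rule blinfun_eqI)
    fix z
    show "(X' o\<^sub>L (id_blinfun - Y)) z = id_blinfun z"
      using arg_cong[OF X', of "\<lambda>T. blinfun_apply T z"]
      by (simp add: blinfun.bilinear_simps algebra_simps)
  qed
  have "X' = X' o\<^sub>L ((id_blinfun - Y) o\<^sub>L X)"
    by (simp add: 1)
  also have "\<dots> = X"
    by (simp add: blinfun_compose_assoc 2)
  finally show ?thesis using 1 2 by blast
qed


section \<open>Complex scalars, complex-linear operators and adjoints\<close>

lemma cinner_scaleC_right: "cinner x (c *\<^sub>C y) = cnj c * cinner x y"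
  by (metis cinner_commute cinner_scaleC_left complex_cnj_mult)

lemma inner_scaleC_left: "inner (c *\<^sub>C x) y = inner x (cnj c *\<^sub>C y)"
  by (simp add: inner_eq_Re_cinner cinner_scaleC_left cinner_scaleC_right)

lemma norm_scaleC: "norm (c *\<^sub>C x) = cmod c * norm x"
proof -
  have "(cnj c * c) *\<^sub>C x = (cmod c)\<^sup>2 *\<^sub>R x"
    by (simp only: scaleR_scaleC complex_norm_square mult.commute)
  then have "inner (c *\<^sub>C x) (c *\<^sub>C x) = (cmod c * norm x)\<^sup>2"
    by (simp add: inner_scaleC_left scaleC_scaleC power2_norm_eq_inner power_mult_distrib)
  then show ?thesis
    by (simp add: norm_eq_sqrt_inner)
qed

lemma scaleC_scaleR: "c *\<^sub>C (r *\<^sub>R x) = r *\<^sub>R (c *\<^sub>C x)"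
  by (simp add: scaleR_scaleC scaleC_scaleC mult.commute)

lemma bounded_linear_scaleC: "bounded_linear (\<lambda>x. c *\<^sub>C x)"
  by (rule bounded_linear_intro[of _ "cmod c"])
    (simp_all add: scaleC_add_right scaleC_scaleR norm_scaleC mult.commute)

lemmas scaleC_zero_right = bounded_linear.linear[OF bounded_linear_scaleC, THEN linear_0]

lemmas scaleC_diff_right = bounded_linear.linear[OF bounded_linear_scaleC, THEN linear_diff]

lemma bounded_ops_scaleC: "T \<in> bounded_ops \<Longrightarrow> T (c *\<^sub>C x) = c *\<^sub>C T x"
  by (simp add: bounded_ops_def)

lemma id_bounded_ops: "id_blinfun \<in> bounded_ops"
  by (simp add: bounded_ops_def)

lemma compose_bounded_ops: "S \<in> bounded_ops \<Longrightarrow> T \<in> bounded_ops \<Longrightarrow> S o\<^sub>L T \<in> bounded_ops"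
  by (simp add: bounded_ops_def)

lemma diff_bounded_ops: "S \<in> bounded_ops \<Longrightarrow> T \<in> bounded_ops \<Longrightarrow> S - T \<in> bounded_ops"
  by (simp add: bounded_ops_def blinfun.diff_left scaleC_diff_right)

lemma add_bounded_ops: "S \<in> bounded_ops \<Longrightarrow> T \<in> bounded_ops \<Longrightarrow> S + T \<in> bounded_ops"
  by (simp add: bounded_ops_def blinfun.add_left scaleC_add_right)

lemma scaleR_bounded_ops: "T \<in> bounded_ops \<Longrightarrow> r *\<^sub>R T \<in> bounded_ops"
  by (simp add: bounded_ops_def blinfun.scaleR_left scaleC_scaleR)

lemma inverse_bounded_ops:
  assumes "S \<in> bounded_ops" "S o\<^sub>L X = id_blinfun" "X o\<^sub>L S = id_blinfun"
  shows "X \<in> bounded_ops"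
proof -
  have inv: "S (X x) = x" "X (S x) = x" for x
    using assms(2,3) by (simp_all add: blinfun_apply_inverse)
  have "X (c *\<^sub>C x) = c *\<^sub>C X x" for c x
  proof -
    have "X (c *\<^sub>C x) = X (S (c *\<^sub>C X x))"
      using bounded_ops_scaleC[OF assms(1)] by (simp add: inv)
    then show ?thesis by (simp add: inv)
  qed
  then show ?thesis by (simp add: bounded_ops_def)
qed

text \<open>The condition on \<open>c\<close> says that \<open>b\<close> is the real part of a
  sesquilinear form; it passes to the representing operator as complex linearity.\<close>

lemma Riesz_sesquilinear:
  fixes b :: "'a::complex_hilbert_space \<Rightarrow> 'a \<Rightarrow> real"
  assumes "bounded_bilinear b" "\<And>c x y. b (c *\<^sub>C x) y = b x (cnj c *\<^sub>C y)"
  shows "\<exists>A \<in> bounded_ops. \<forall>x y. inner (A x) y = b x y"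
proof -
  obtain A :: "'a \<Rightarrow>\<^sub>L 'a" where A: "\<And>x y. inner (A x) y = b x y"
    using Riesz_bilinear[OF assms(1)] by blast
  have "A (c *\<^sub>C x) = c *\<^sub>C A x" for c x
    by (rule vector_eq_rdot[THEN iffD1]) (simp add: A assms(2) inner_scaleC_left)
  then show ?thesis using A by (auto simp: bounded_ops_def)
qed

text \<open>The imaginary part of \<open>cinner u v\<close> is the real part of
  \<open>cinner ((- \<i>) *\<^sub>C u) v\<close>, and complex linearity of \<open>T\<close> moves
  this scalar through.\<close>

lemma cinner_eqI_inner:
  assumes "T \<in> bounded_ops" "\<And>x y. inner (T x) y = inner x (S y)"
  shows "cinner (T x) y = cinner x (S y)"
proof (rule complex_eqI)
  show "Re (cinner (T x) y) = Re (cinner x (S y))"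
    using assms(2) by (simp add: inner_eq_Re_cinner)
  have Im: "Im (cinner u v) = inner ((- \<i>) *\<^sub>C u) v" for u v :: 'a
    by (simp add: inner_eq_Re_cinner cinner_scaleC_left)
  show "Im (cinner (T x) y) = Im (cinner x (S y))"
    unfolding Im by (simp add: assms(2) flip: bounded_ops_scaleC[OF assms(1)])
qed

lemma cadjoint_eqI:
  assumes "T \<in> bounded_ops" "S \<in> bounded_ops" "\<And>x y. inner (T x) y = inner x (S y)"
  shows "cadjoint T = S"
  unfolding cadjoint_def
proof (rule the_equality)
  show "S \<in> bounded_ops \<and> (\<forall>x y. cinner (T x) y = cinner x (S y))"
    using assms(2) cinner_eqI_inner[OF assms(1,3)] by blast
  fix R assume "R \<in> bounded_ops \<and> (\<forall>x y. cinner (T x) y = cinner x (R y))"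
  then have "inner x (R y) = inner x (S y)" for x y
    using assms(3)[of x y] by (simp add: inner_eq_Re_cinner)
  then show "R = S"
    by (intro blinfun_eqI) (metis vector_eq_ldot)
qed

text \<open>This gives the existence behind the definite description in \<open>cadjoint\<close>: the
  adjoint represents the form \<open>inner u (T v)\<close>. Uniqueness comes from
  \<open>cadjoint_eqI\<close>.\<close>

lemma inner_cadjoint:
  assumes "T \<in> bounded_ops"
  shows "inner (T x) y = inner x (cadjoint T y)"
proof -
  have "bounded_bilinear (\<lambda>u v. inner u (T v))"
    by (rule bounded_bilinear.comp[OF bounded_bilinear_inner bounded_linear_ident blinfun.bounded_linear_right])
  moreover have "inner (c *\<^sub>C u) (T v) = inner u (T (cnj c *\<^sub>C v))" for c u v
    using assms by (simp add: bounded_ops_scaleC inner_scaleC_left)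
  ultimately obtain S where S: "S \<in> bounded_ops" "\<And>u v. inner (S u) v = inner u (T v)"
    using Riesz_sesquilinear[of "\<lambda>u v. inner u (T v)"] by blast
  then have "cadjoint T = S"
    using assms by (intro cadjoint_eqI) (metis inner_commute)+
  then show ?thesis
    using S(2)[of y x] by (simp add: inner_commute)
qed

lemma norm_cadjoint_le:
  assumes "T \<in> bounded_ops"
  shows "norm (cadjoint T y) \<le> norm T * norm y"
proof (cases "cadjoint T y = 0")
  case False
  have "norm (cadjoint T y) * norm (cadjoint T y) = inner (T (cadjoint T y)) y"
    using inner_cadjoint[OF assms, of "cadjoint T y" y] by (simp add: power2_norm_eq_inner flip: power2_eq_square)
  also have "\<dots> \<le> norm (T (cadjoint T y)) * norm y"
    by (rule norm_cauchy_schwarz)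
  also have "\<dots> \<le> norm T * norm (cadjoint T y) * norm y"
    by (intro mult_right_mono norm_blinfun) auto
  finally have "norm (cadjoint T y) * norm (cadjoint T y) \<le> norm (cadjoint T y) * (norm T * norm y)"
    by (simp add: ac_simps)
  with False show ?thesis by simp
qed simp

text \<open>\<open>(I - Y)\<^sup>2 = I - T\<close> is the fixed point equation \<open>Y = (T + Y\<^sup>2) / 2\<close>.\<close>

lemma sqrt_one_minus:
  fixes T :: "'a::complex_hilbert_space \<Rightarrow>\<^sub>L 'a"
  assumes T: "T \<in> bounded_ops" "selfadjoint T" "norm T < 1"
  shows "\<exists>Y \<in> bounded_ops. selfadjoint Y \<and> norm Y < 1 \<and>
           (id_blinfun - Y) o\<^sub>L (id_blinfun - Y) = id_blinfun - T"
proof -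
  interpret c: bounded_bilinear "(o\<^sub>L) :: ('a \<Rightarrow>\<^sub>L 'a) \<Rightarrow> ('a \<Rightarrow>\<^sub>L 'a) \<Rightarrow> ('a \<Rightarrow>\<^sub>L 'a)"
    by (rule bounded_bilinear_blinfun_compose)
  \<comment> \<open>The smaller root of \<open>r^2 - 2 r + norm T = 0\<close>: the map
    \<open>\<Phi>\<close> then sends the ball of radius \<open>r\<close> into itself and contracts
    it by the factor \<open>r < 1\<close>.\<close>
  define r where "r = 1 - sqrt (1 - norm T)"
  have r: "0 \<le> r" "r < 1" "norm T + r\<^sup>2 = 2 * r"
    using T(3) by (auto simp: r_def power2_diff)
  \<comment> \<open>Iterating inside this closed set makes the fixed point complex-linear and
    self-adjoint.\<close>
  define V :: "('a \<Rightarrow>\<^sub>L 'a) set" where "V = {Y. Y \<in> bounded_ops \<and> selfadjoint Y}"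
  define \<Phi> where "\<Phi> Y = (1/2) *\<^sub>R (T + (Y o\<^sub>L Y))" for Y
  have "V = {Y :: 'a \<Rightarrow>\<^sub>L 'a. (\<forall>c x. Y (c *\<^sub>C x) = c *\<^sub>C Y x) \<and> (\<forall>x y. inner (Y x) y = inner x (Y y))}"
    by (auto simp: V_def bounded_ops_def selfadjoint_def)
  moreover have "closed \<dots>"
    by (intro closed_Collect_conj closed_Collect_all closed_Collect_eq continuous_intros
        bounded_linear.continuous_on[OF bounded_linear_scaleC])
  ultimately have "complete (V \<inter> cball 0 r)"
    by (auto simp: complete_eq_closed)
  moreover have "0 \<in> V \<inter> cball 0 r"
    using r by (simp add: scaleC_zero_right V_def bounded_ops_def selfadjoint_def)
  moreover have "\<Phi> ` (V \<inter> cball 0 r) \<subseteq> V \<inter> cball 0 r"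
  proof clarify
    fix Y assume Y: "Y \<in> V" "Y \<in> cball 0 r"
    have "norm (\<Phi> Y) \<le> (norm T + norm Y * norm Y) / 2"
      using norm_triangle_ineq[of T "Y o\<^sub>L Y"] norm_blinfun_compose[of Y Y] by (simp add: \<Phi>_def)
    also have "\<dots> \<le> (norm T + r * r) / 2"
      using Y r by (intro divide_right_mono add_left_mono mult_mono) auto
    also have "\<dots> = r" using r(3) by (simp add: power2_eq_square)
    finally have "\<Phi> Y \<in> cball 0 r" by simp
    moreover have "\<Phi> Y \<in> bounded_ops"
      using Y T by (auto simp: \<Phi>_def V_def intro!: scaleR_bounded_ops add_bounded_ops compose_bounded_ops)
    moreover have "selfadjoint (\<Phi> Y)"
      using Y T by (simp add: \<Phi>_def V_def selfadjoint_def blinfun.bilinear_simps inner_simps)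
    ultimately show "\<Phi> Y \<in> V \<inter> cball 0 r" by (simp add: V_def)
  qed
  moreover have "dist (\<Phi> Y) (\<Phi> Z) \<le> r * dist Y Z" if "Y \<in> V \<inter> cball 0 r" "Z \<in> V \<inter> cball 0 r" for Y Z
  proof -
    \<comment> \<open>The difference of squares is factored without assuming that \<open>Y\<close>
      and \<open>Z\<close> commute.\<close>
    have "\<Phi> Y - \<Phi> Z = (1/2) *\<^sub>R ((Y o\<^sub>L (Y - Z)) + ((Y - Z) o\<^sub>L Z))"
      by (simp add: \<Phi>_def c.diff_left c.diff_right flip: scaleR_diff_right)
    then have "norm (\<Phi> Y - \<Phi> Z) \<le> (norm Y * norm (Y - Z) + norm (Y - Z) * norm Z) / 2"
      using norm_triangle_ineq[of "Y o\<^sub>L (Y - Z)" "(Y - Z) o\<^sub>L Z"]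
        norm_blinfun_compose[of Y "Y - Z"] norm_blinfun_compose[of "Y - Z" Z] by simp
    also have "\<dots> \<le> (r * norm (Y - Z) + norm (Y - Z) * r) / 2"
      using that r by (intro divide_right_mono add_mono mult_mono) auto
    finally show ?thesis by (simp add: dist_norm mult.commute)
  qed
  ultimately obtain Y where Y: "Y \<in> V \<inter> cball 0 r" "\<Phi> Y = Y"
    using Banach_fix[of "V \<inter> cball 0 r" r \<Phi>] r by (metis empty_iff)
  have "T + (Y o\<^sub>L Y) = 2 *\<^sub>R \<Phi> Y"
    by (simp add: \<Phi>_def)
  then have "T + (Y o\<^sub>L Y) = Y + Y"
    using Y(2) by (simp add: scaleR_2)
  then have "(id_blinfun - Y) o\<^sub>L (id_blinfun - Y) = id_blinfun - T"
    by (simp add: c.diff_left c.diff_right algebra_simps)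
  then show ?thesis
    using Y r by (intro bexI[of _ Y]) (auto simp: V_def)
qed

subsection \<open>Uniform boundedness of the representation\<close>

context
  fixes \<pi> :: "'g::{topological_group_add,t2_space} \<Rightarrow> ('h::complex_hilbert_space \<Rightarrow>\<^sub>L 'h)"
  assumes rep: "continuous_representation \<pi>"
begin

lemma rep_bounded_ops: "\<pi> g \<in> bounded_ops"
  and rep_zero: "\<pi> 0 = id_blinfun"
  and rep_add: "\<pi> (g + h) = \<pi> g o\<^sub>L \<pi> h"
  using rep by (auto simp: continuous_representation_def)

lemma rep_apply_add: "\<pi> g (\<pi> h x) = \<pi> (g + h) x"
  by (simp add: rep_add)

lemma continuous_on_rep: "continuous_on UNIV (\<lambda>g. \<pi> g x)"
  using rep by (simp add: continuous_representation_def continuous_on_strong_operator_topo_iff_coordinatewise)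

lemma continuous_on_rep_uminus: "continuous_on UNIV (\<lambda>g. \<pi> (- g) x)"
  by (rule continuous_on_compose2[OF continuous_on_rep]) (auto intro: continuous_intros)

text \<open>Strong continuity bounds each orbit over a compact set, and Banach--Steinhaus makes the
  bound uniform. It later ensures that the squared norms are integrable over compact sets.\<close>

lemma norm_rep_bounded_on_compact:
  assumes "compact A"
  shows "\<exists>B. \<forall>g\<in>A. norm (\<pi> g) \<le> B"
proof (rule uniform_boundedness)
  fix x
  have "compact ((\<lambda>g. \<pi> g x) ` A)"
    using assms by (intro compact_continuous_image continuous_on_subset[OF continuous_on_rep]) auto
  then show "\<exists>B. \<forall>g\<in>A. norm (\<pi> g x) \<le> B"
    by (auto dest!: compact_imp_bounded simp: bounded_iff)
qed

text \<open>Strong continuity of \<open>\<pi>\<close> passes to the adjoints only weakly. The norm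
  of \<open>cadjoint (\<pi> g) y\<close> is still a supremum of continuous functions
  \<open>inner (\<pi> g z) y\<close> over the unit ball, hence lower semicontinuous, which is enough
  for measurability.\<close>

lemma closed_norm_cadjoint_rep_le: "closed {g. norm (cadjoint (\<pi> g) y) \<le> t}"
proof -
  have iff: "norm w \<le> t \<longleftrightarrow> (\<forall>z. norm z \<le> 1 \<longrightarrow> inner z w \<le> t)" for w :: 'h
  proof safe
    fix z :: 'h assume "norm w \<le> t" "norm z \<le> 1"
    then show "inner z w \<le> t"
      using norm_cauchy_schwarz[of z w] mult_right_mono[of "norm z" 1 "norm w"] by simp
  next
    assume *: "\<forall>z. norm z \<le> 1 \<longrightarrow> inner z w \<le> t"
    show "norm w \<le> t"
    proof (cases "w = 0")
      case True
      then show ?thesis using *[rule_format, of 0] by simp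
    next
      case False
      then show ?thesis
        using *[rule_format, of "(1 / norm w) *\<^sub>R w"] by (simp add: power2_norm_eq_inner[symmetric] power2_eq_square)
    qed
  qed
  have "{g. norm (cadjoint (\<pi> g) y) \<le> t} = {g. \<forall>z. norm z \<le> 1 \<longrightarrow> inner (\<pi> g z) y \<le> t}"
    by (simp add: iff inner_cadjoint[OF rep_bounded_ops])
  moreover have "closed \<dots>"
    by (intro closed_Collect_all closed_Collect_imp open_Collect_const closed_Collect_le
        continuous_on_inner continuous_on_rep continuous_on_const)
  ultimately show ?thesis by simp
qed

lemma borel_measurable_norm_cadjoint_rep: "(\<lambda>g. norm (cadjoint (\<pi> g) y)) \<in> borel_measurable borel"
  by (rule borel_measurableI_le) (simp add: borel_closed closed_norm_cadjoint_rep_le)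

end

section \<open>The Chebyshev argument on a pair of compact sets\<close>

context unimodular_group
begin

lemma measure_large_le:
  fixes \<phi> :: "'g \<Rightarrow> real"
  assumes A: "compact A" "0 < emeasure m A"
    and \<phi>: "\<phi> \<in> borel_measurable borel" "\<And>g. 0 \<le> \<phi> g" "\<And>g. g \<in> A \<Longrightarrow> \<phi> g \<le> D"
    and mean: "1 / measure m A * (LINT g:A|m. \<phi> g) \<le> t" and "0 < c"
  shows "measure m {g \<in> A. c \<le> \<phi> g} \<le> t / c * measure m A"
proof -
  have [measurable]: "A \<in> sets m"
    using A by (auto intro: borel_compact)
  have \<phi>m [measurable]: "\<phi> \<in> borel_measurable m"
    using \<phi>(1) by simp
  have fin: "emeasure m A < \<infinity>" using emeasure_compact A by blast
  have pos: "0 < measure m A"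
    using A fin by (simp add: measure_def enn2real_positive_iff)
  \<comment> \<open>Without integrability, supplied by the bound \<open>D\<close>, the integral
    would default to 0 and \<open>mean\<close> would carry no information.\<close>
  have int: "integrable m (\<lambda>g. indicator A g *\<^sub>R \<phi> g)"
  proof (rule integrableI_bounded_set_indicator[of A _ _ D])
    show "AE g in m. g \<in> A \<longrightarrow> norm (\<phi> g) \<le> D"
      using \<phi> by auto
  qed (use fin \<open>A \<in> sets m\<close> in auto)
  have "{g \<in> A. c \<le> \<phi> g} = {g \<in> space m. c \<le> indicator A g *\<^sub>R \<phi> g}"
    using \<open>0 < c\<close> by (auto simp: indicator_def)
  then have "measure m {g \<in> A. c \<le> \<phi> g} \<le> (LINT g:A|m. \<phi> g) / c"
    using integral_Markov_inequality_measure[OF int, of A c] \<open>0 < c\<close> \<phi>(2) \<open>A \<in> sets m\<close>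
    by (simp add: set_lebesgue_integral_def)
  also have "\<dots> \<le> t * measure m A / c"
    using mean pos \<open>0 < c\<close> by (intro divide_right_mono) (auto simp: field_simps)
  finally show ?thesis by simp
qed

text \<open>The reverse inequality, obtained by applying \<open>emeasure_uminus_le\<close> to the
  reflected set.\<close>

lemma measure_uminus_ge:
  assumes "compact A" "compact S" "uminus ` S = S" "0 < emeasure m S"
  shows "measure m A \<le> measure m (uminus ` A)"
proof -
  have comp: "compact (uminus ` A)"
    using assms(1) by (intro compact_continuous_image continuous_intros)
  have "uminus ` uminus ` A = A" by (simp add: image_image)
  then have "emeasure m A \<le> emeasure m (uminus ` A)"
    using emeasure_uminus_le[OF comp assms(2-4)] by simp
  then show ?thesis
    using emeasure_compact[OF comp] by (simp add: measure_def enn2real_mono)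
qed

text \<open>Applied with \<open>F N\<close> and \<open>F (p * N)\<close> for \<open>A\<close> and
  \<open>A'\<close>. The good \<open>v\<close> fill three quarters of \<open>A\<close>, so the
  elements \<open>g - v\<close> occupy at least that much of \<open>A'\<close>, while the bad
  \<open>u\<close> in \<open>A'\<close> have measure at most a quarter of that of \<open>A\<close>.
  Some good \<open>v\<close> thus has a good \<open>g - v\<close>.\<close>

lemma norm_rep_le:
  fixes \<pi> :: "'g \<Rightarrow> ('h::complex_hilbert_space \<Rightarrow>\<^sub>L 'h)"
  assumes rep: "continuous_representation \<pi>"
    and A: "compact A" "uminus ` A = A" "0 < emeasure m A"
    and A': "compact A'" "0 < emeasure m A'" "\<And>a. a \<in> A \<Longrightarrow> g - a \<in> A'"
      "measure m A' \<le> K * measure m A"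
    and K: "0 < K" and C: "0 < C"
    and mean: "\<And>x. 1 / measure m A * (LINT h:A|m. (norm (\<pi> h x))\<^sup>2) \<le> C\<^sup>2 * (norm x)\<^sup>2"
    and mean': "\<And>x. 1 / measure m A' * (LINT h:A'|m. (norm (cadjoint (\<pi> h) x))\<^sup>2) \<le> C\<^sup>2 * (norm x)\<^sup>2"
  shows "norm (\<pi> g) \<le> (2 * C * (K + 1))\<^sup>2"
proof -
  \<comment> \<open>Large enough that both exceptional sets have measure at most a quarter of that
    of \<open>A\<close>, since \<open>(K + 1)\<^sup>2\<close> dominates both 1 and
    \<open>K\<close>.\<close>
  define c where "c = 2 * C * (K + 1)"
  have c: "0 < c" using C K by (simp add: c_def)
  have "1 * (4 * C\<^sup>2) \<le> (K + 1)\<^sup>2 * (4 * C\<^sup>2)" "K * (4 * C\<^sup>2) \<le> (K + 1)\<^sup>2 * (4 * C\<^sup>2)"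
    using K by (intro mult_right_mono; simp add: power2_eq_square algebra_simps)+
  moreover have "c\<^sup>2 = (K + 1)\<^sup>2 * (4 * C\<^sup>2)"
    by (simp add: c_def power_mult_distrib)
  ultimately have "4 * C\<^sup>2 \<le> c\<^sup>2" "K * (4 * C\<^sup>2) \<le> c\<^sup>2"
    by simp_all
  then have cc: "C\<^sup>2 / c\<^sup>2 \<le> 1 / 4" "C\<^sup>2 / c\<^sup>2 * K \<le> 1 / 4"
    using c by (simp_all add: divide_simps ac_simps)
  have finA: "emeasure m A < \<infinity>" "emeasure m A' < \<infinity>" using emeasure_compact A A' by blast+
  then have pos: "0 < measure m A"
    using A by (simp add: measure_def enn2real_positive_iff)
  \<comment> \<open>Nonzero vectors keep the Chebyshev thresholds positive; the zero cases are
    treated at the end.\<close>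
  have bound: "\<bar>inner (\<pi> g x) y\<bar> \<le> c\<^sup>2 * norm x * norm y" if "x \<noteq> 0" "y \<noteq> 0" for x y
  proof -
    define E where "E = {v \<in> A. norm (\<pi> v x) \<le> c * norm x}"
    define E' where "E' = {u \<in> A'. norm (cadjoint (\<pi> u) y) \<le> c * norm y}"
    have sets [measurable]: "A \<in> sets m" "A' \<in> sets m"
      using A A' by (auto intro: borel_compact)
    \<comment> \<open>Compactness is wanted here because the inversion inequality is stated for
      compact sets.\<close>
    have compE: "compact E"
    proof -
      have "closed {v. norm (\<pi> v x) \<le> c * norm x}"
        by (intro closed_Collect_le continuous_on_norm continuous_on_rep[OF rep] continuous_on_const)
      moreover have "E = A \<inter> {v. norm (\<pi> v x) \<le> c * norm x}" by (auto simp: E_def)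
      ultimately show ?thesis using A(1) by (simp add: compact_Int_closed)
    qed
    have setE' [measurable]: "E' \<in> sets m"
    proof -
      have "E' = A' \<inter> {u. norm (cadjoint (\<pi> u) y) \<le> c * norm y}" by (auto simp: E'_def)
      then show ?thesis
        using sets(2) borel_closed[OF closed_norm_cadjoint_rep_le[OF rep]] by auto
    qed
    have scale: "C\<^sup>2 * (norm z)\<^sup>2 / (c * norm z)\<^sup>2 = C\<^sup>2 / c\<^sup>2" "0 < (c * norm z)\<^sup>2" if "z \<noteq> 0" for z :: 'h
      using that c by (simp_all add: power_mult_distrib)
    obtain B where B: "\<And>v. v \<in> A \<Longrightarrow> norm (\<pi> v) \<le> B"
      using norm_rep_bounded_on_compact[OF rep A(1)] by blast
    obtain B' where B': "\<And>v. v \<in> A' \<Longrightarrow> norm (\<pi> v) \<le> B'"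
      using norm_rep_bounded_on_compact[OF rep A'(1)] by blast
    have "measure m {v \<in> A. (c * norm x)\<^sup>2 \<le> (norm (\<pi> v x))\<^sup>2} \<le> C\<^sup>2 / c\<^sup>2 * measure m A"
      unfolding scale(1)[OF \<open>x \<noteq> 0\<close>, symmetric]
    proof (rule measure_large_le[OF A(1,3) _ _ _ mean scale(2)[OF \<open>x \<noteq> 0\<close>]])
      show "(\<lambda>v. (norm (\<pi> v x))\<^sup>2) \<in> borel_measurable borel"
        by (intro borel_measurable_continuous_onI continuous_intros continuous_on_rep[OF rep])
      show "(norm (\<pi> v x))\<^sup>2 \<le> (B * norm x)\<^sup>2" if "v \<in> A" for v
        using norm_blinfun[of "\<pi> v" x] mult_right_mono[OF B[OF that], of "norm x"]
        by (intro power_mono) auto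
    qed simp
    also have "\<dots> \<le> 1 / 4 * measure m A"
      using cc by (intro mult_right_mono) auto
    finally have small: "measure m {v \<in> A. (c * norm x)\<^sup>2 \<le> (norm (\<pi> v x))\<^sup>2} \<le> 1 / 4 * measure m A" .
    have "measure m {u \<in> A'. (c * norm y)\<^sup>2 \<le> (norm (cadjoint (\<pi> u) y))\<^sup>2} \<le> C\<^sup>2 / c\<^sup>2 * measure m A'"
      unfolding scale(1)[OF \<open>y \<noteq> 0\<close>, symmetric]
    proof (rule measure_large_le[OF A'(1,2) _ _ _ mean' scale(2)[OF \<open>y \<noteq> 0\<close>]])
      show "(\<lambda>v. (norm (cadjoint (\<pi> v) y))\<^sup>2) \<in> borel_measurable borel"
        using borel_measurable_norm_cadjoint_rep[OF rep, of y] by measurable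
      show "(norm (cadjoint (\<pi> v) y))\<^sup>2 \<le> (B' * norm y)\<^sup>2" if "v \<in> A'" for v
        using norm_cadjoint_le[OF rep_bounded_ops[OF rep], of v y] mult_right_mono[OF B'[OF that], of "norm y"]
        by (intro power_mono) auto
    qed simp
    also have "\<dots> \<le> C\<^sup>2 / c\<^sup>2 * (K * measure m A)"
      using A'(4) by (intro mult_left_mono) auto
    also have "\<dots> \<le> 1 / 4 * measure m A"
      using mult_right_mono[OF cc(2), of "measure m A"] by (simp add: mult.assoc)
    finally have small': "measure m {u \<in> A'. (c * norm y)\<^sup>2 \<le> (norm (cadjoint (\<pi> u) y))\<^sup>2} \<le> 1 / 4 * measure m A" .
    have setE: "E \<in> sets m"
      using borel_compact[OF compE] by simp
    have sub: "A - E \<subseteq> {v \<in> A. (c * norm x)\<^sup>2 \<le> (norm (\<pi> v x))\<^sup>2}"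
      using c by (auto simp: E_def intro!: power_mono)
    have fm: "{v \<in> A. (c * norm x)\<^sup>2 \<le> (norm (\<pi> v x))\<^sup>2} \<in> fmeasurable m"
    proof (rule fmeasurableI2[of A])
      have "closed {v. (c * norm x)\<^sup>2 \<le> (norm (\<pi> v x))\<^sup>2}"
        by (intro closed_Collect_le continuous_intros continuous_on_rep[OF rep])
      moreover have "{v \<in> A. (c * norm x)\<^sup>2 \<le> (norm (\<pi> v x))\<^sup>2} = A \<inter> {v. (c * norm x)\<^sup>2 \<le> (norm (\<pi> v x))\<^sup>2}"
        by auto
      ultimately show "{v \<in> A. (c * norm x)\<^sup>2 \<le> (norm (\<pi> v x))\<^sup>2} \<in> sets m"
        using sets by (auto intro: borel_closed)
    qed (use finA sets in \<open>auto intro!: fmeasurableI\<close>)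
    have "measure m (A - E) \<le> 1 / 4 * measure m A"
      using measure_mono_fmeasurable[OF sub _ fm] small setE sets by simp
    moreover have "measure m (A - E) = measure m A - measure m E"
      using finA setE sets by (intro measure_Diff) (auto simp: E_def)
    ultimately have "3 / 4 * measure m A \<le> measure m E"
      by simp
    moreover have compE': "compact (uminus ` E)"
      using compE by (intro compact_continuous_image continuous_intros)
    \<comment> \<open>Inversion enters because \<open>g - v\<close> is the left translate by
      \<open>g\<close> of \<open>- v\<close>.\<close>
    moreover have "measure m E \<le> measure m (uminus ` E)"
      using measure_uminus_ge[OF compE A] .
    moreover have "measure m ((\<lambda>a. g + a) ` uminus ` E) = measure m (uminus ` E)"
      using emeasure_left[OF borel_compact[OF compE']] by (simp add: measure_def)
    ultimately have large: "3 / 4 * measure m A \<le> measure m ((\<lambda>a. g + a) ` uminus ` E)"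
      by simp
    have "\<exists>v\<in>E. g - v \<in> E'"
    proof (rule ccontr)
      assume "\<not> ?thesis"
      then have sub: "(\<lambda>a. g + a) ` uminus ` E \<subseteq> {u \<in> A'. (c * norm y)\<^sup>2 \<le> (norm (cadjoint (\<pi> u) y))\<^sup>2}"
        using A'(3) c by (auto simp: E_def E'_def intro!: power_mono)
      have meas: "{u \<in> A'. (c * norm y)\<^sup>2 \<le> (norm (cadjoint (\<pi> u) y))\<^sup>2} \<in> fmeasurable m"
      proof (rule fmeasurableI2[of A'])
        have [measurable]: "(\<lambda>v. norm (cadjoint (\<pi> v) y)) \<in> borel_measurable m"
          using borel_measurable_norm_cadjoint_rep[OF rep, of y] by simp
        have "{u \<in> space m. u \<in> A' \<and> (c * norm y)\<^sup>2 \<le> (norm (cadjoint (\<pi> u) y))\<^sup>2} \<in> sets m"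
          by measurable
        then show "{u \<in> A'. (c * norm y)\<^sup>2 \<le> (norm (cadjoint (\<pi> u) y))\<^sup>2} \<in> sets m"
          by simp
      qed (use finA sets in \<open>auto intro!: fmeasurableI\<close>)
      have "(\<lambda>a. g + a) ` uminus ` E \<in> sets m"
        unfolding sets_m by (intro borel_compact compact_continuous_image[OF _ compE'] continuous_intros)
      from measure_mono_fmeasurable[OF sub this meas] large small' pos
      show False by linarith
    qed
    then obtain v where v: "v \<in> E" "g - v \<in> E'" by blast
    have "inner (\<pi> g x) y = inner (\<pi> (g - v) (\<pi> v x)) y"
      by (simp add: rep_apply_add[OF rep])
    also have "\<dots> = inner (\<pi> v x) (cadjoint (\<pi> (g - v)) y)"
      by (rule inner_cadjoint[OF rep_bounded_ops[OF rep]])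
    finally have "\<bar>inner (\<pi> g x) y\<bar> \<le> norm (\<pi> v x) * norm (cadjoint (\<pi> (g - v)) y)"
      by (simp add: Cauchy_Schwarz_ineq2)
    also have "\<dots> \<le> (c * norm x) * (c * norm y)"
      using v c by (intro mult_mono) (auto simp: E_def E'_def)
    finally show ?thesis by (simp add: power2_eq_square ac_simps)
  qed
  show ?thesis
    unfolding c_def[symmetric]
  proof (rule norm_blinfun_bound)
    fix x
    show "norm (\<pi> g x) \<le> c\<^sup>2 * norm x"
    proof (cases "\<pi> g x = 0 \<or> x = 0")
      case False
      then have "norm (\<pi> g x) * norm (\<pi> g x) \<le> c\<^sup>2 * norm x * norm (\<pi> g x)"
        using bound[of x "\<pi> g x"] by (simp add: power2_norm_eq_inner flip: power2_eq_square)
      with False show ?thesis by simp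
    qed (auto simp: blinfun.zero_right)
  qed simp
qed

end

subsection \<open>Unitarizing a bounded representation\<close>

lemma Linfty_add:
  assumes "f \<in> Linfty m" "h \<in> Linfty m"
  shows "(\<lambda>x. f x + h x) \<in> Linfty m"
proof -
  obtain B D where "AE x in m. \<bar>f x\<bar> \<le> B" "AE x in m. \<bar>h x\<bar> \<le> D"
    using assms by (auto simp: Linfty_def)
  then have "AE x in m. \<bar>f x + h x\<bar> \<le> B + D"
    by eventually_elim simp
  then show ?thesis
    using assms by (auto simp: Linfty_def)
qed

lemma Linfty_cmult:
  assumes "f \<in> Linfty m"
  shows "(\<lambda>x. c * f x) \<in> Linfty m"
proof -
  obtain B where "AE x in m. \<bar>f x\<bar> \<le> B"
    using assms by (auto simp: Linfty_def)
  then have "AE x in m. \<bar>c * f x\<bar> \<le> \<bar>c\<bar> * B"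
    by eventually_elim (simp add: abs_mult mult_left_mono)
  then show ?thesis
    using assms by (auto simp: Linfty_def)
qed

lemma Linfty_one: "(\<lambda>x. 1) \<in> Linfty m"
  by (auto simp: Linfty_def)

context
  fixes m :: "'a measure" and M :: "('a \<Rightarrow> real) \<Rightarrow> real"
  assumes add: "\<And>f h. f \<in> Linfty m \<Longrightarrow> h \<in> Linfty m \<Longrightarrow> M (\<lambda>x. f x + h x) = M f + M h"
    and cmult: "\<And>f c. f \<in> Linfty m \<Longrightarrow> M (\<lambda>x. c * f x) = c * M f"
    and pos: "\<And>f. f \<in> Linfty m \<Longrightarrow> AE x in m. 0 \<le> f x \<Longrightarrow> 0 \<le> M f"
    and one: "M (\<lambda>x. 1) = 1"
begin

lemma mean_ge:
  assumes "f \<in> Linfty m" "\<And>x. c \<le> f x"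
  shows "c \<le> M f"
proof -
  have "(\<lambda>x. (- c) * 1) \<in> Linfty m"
    by (rule Linfty_cmult[OF Linfty_one])
  then have "0 \<le> M (\<lambda>x. f x + (- c) * 1)"
    using assms by (intro pos Linfty_add) auto
  also have "\<dots> = M f + M (\<lambda>x. (- c) * 1)"
    using assms by (intro add Linfty_cmult[OF Linfty_one])
  also have "M (\<lambda>x. (- c) * 1) = - c"
    using cmult[OF Linfty_one, of "- c"] one by simp
  finally show ?thesis by simp
qed

lemma mean_le:
  assumes "f \<in> Linfty m" "\<And>x. f x \<le> c"
  shows "M f \<le> c"
  using mean_ge[OF Linfty_cmult[OF assms(1), of "- 1"], of "- c"] cmult[OF assms(1), of "- 1"] assms(2)
  by simp

lemma mean_abs_le:
  assumes "f \<in> Linfty m" "\<And>x. \<bar>f x\<bar> \<le> c"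
  shows "\<bar>M f\<bar> \<le> c"
  using mean_le[OF assms(1), of c] mean_ge[OF assms(1), of "- c"] assms(2)
  by (simp add: abs_le_iff minus_le_iff)

end

section \<open>Invariant inner products and similarity to a unitary representation\<close>

text \<open>If \<open>A\<close> represents \<open>b\<close> and \<open>S\<close> is the square root
  of \<open>A / \<beta>\<close>, then \<open>inner (S x) (S y)\<close> is
  \<open>b x y / \<beta>\<close>. Invariance of \<open>b\<close> thus makes conjugation by
  \<open>S\<close> isometric.\<close>

lemma invariant_form_imp_unitarizable:
  fixes \<pi> :: "'g::{topological_group_add,t2_space} \<Rightarrow> ('h::complex_hilbert_space \<Rightarrow>\<^sub>L 'h)"
  assumes rep: "continuous_representation \<pi>"
    and b: "bounded_bilinear b" "\<And>x y. b x y = b y x" "\<And>c x y. b (c *\<^sub>C x) y = b x (cnj c *\<^sub>C y)"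
    and invariant: "\<And>g x y. b (\<pi> g x) (\<pi> g y) = b x y"
    and bounds: "0 < \<delta>" "\<And>x. \<delta> * (norm x)\<^sup>2 \<le> b x x" "\<And>x. b x x \<le> \<beta> * (norm x)\<^sup>2" "\<delta> \<le> \<beta>"
  shows "unitarizable \<pi>"
proof -
  obtain A where A: "A \<in> bounded_ops" "\<And>x y. inner (A x) y = b x y"
    using Riesz_sesquilinear[OF b(1,3)] by blast
  \<comment> \<open>Dividing by the upper bound \<open>\<beta>\<close> places the quadratic form of
    \<open>T\<close> between 0 and \<open>1 - \<delta> / \<beta>\<close>, so
    \<open>norm T < 1\<close> and \<open>sqrt_one_minus\<close> applies.\<close>
  define T where "T = id_blinfun - (1/\<beta>) *\<^sub>R A"
  have \<beta>: "0 < \<beta>" using bounds by simp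
  have T_inner: "inner (T x) y = inner x y - b x y / \<beta>" for x y
    by (simp add: T_def blinfun.bilinear_simps inner_simps A)
  have "T \<in> bounded_ops"
    unfolding T_def by (intro diff_bounded_ops id_bounded_ops scaleR_bounded_ops A)
  moreover have T_sa: "selfadjoint T"
    by (simp add: selfadjoint_def T_inner inner_commute[of _ "T _"] b(2)) (simp add: inner_commute)
  moreover have "norm T < 1"
  proof -
    have "norm T \<le> 1 - \<delta> / \<beta>"
    proof (rule norm_selfadjoint_le[OF T_sa])
      show "0 \<le> 1 - \<delta> / \<beta>" using bounds by (simp add: field_simps)
      show "0 \<le> inner (T x) x" for x
        using bounds(3)[of x] \<beta> by (simp add: T_inner field_simps power2_norm_eq_inner)
      show "inner (T x) x \<le> (1 - \<delta> / \<beta>) * (norm x)\<^sup>2" for x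
        using divide_right_mono[OF bounds(2)[of x], of \<beta>] \<beta>
        by (simp add: T_inner left_diff_distrib power2_norm_eq_inner)
    qed
    then show ?thesis using bounds \<beta> by (smt (verit) divide_pos_pos)
  qed
  ultimately obtain Y where Y: "Y \<in> bounded_ops" "selfadjoint Y" "norm Y < 1"
      "(id_blinfun - Y) o\<^sub>L (id_blinfun - Y) = id_blinfun - T"
    using sqrt_one_minus by blast
  define S where "S = id_blinfun - Y"
  obtain X where X: "S o\<^sub>L X = id_blinfun" "X o\<^sub>L S = id_blinfun"
    using inverse_one_minus[OF Y(3)] unfolding S_def by blast
  have S: "S \<in> bounded_ops"
    unfolding S_def by (intro diff_bounded_ops id_bounded_ops Y)
  have X_ops: "X \<in> bounded_ops"
    by (rule inverse_bounded_ops[OF S X])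
  have SX: "S (X x) = x" "X (S x) = x" for x
    using X by (simp_all add: blinfun_apply_inverse)
  have S_inner: "inner (S x) (S y) = b x y / \<beta>" for x y
  proof -
    have "inner (S x) (S y) = inner (S (S x)) y"
      using Y(2) by (simp add: S_def selfadjoint_def blinfun.bilinear_simps inner_simps)
    also have "S (S x) = x - T x"
      using arg_cong[OF Y(4), of "\<lambda>T. blinfun_apply T x"] by (simp add: S_def blinfun.diff_left)
    finally show ?thesis by (simp add: inner_simps T_inner)
  qed
  \<comment> \<open>In the definition of \<open>unitarizable\<close>, \<open>L\<close> is
    \<open>X\<close> and \<open>L'\<close> is \<open>S\<close>.\<close>
  define V where "V g = S o\<^sub>L \<pi> g o\<^sub>L X" for g
  have V_apply: "V g x = S (\<pi> g (X x))" for g x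
    by (simp add: V_def)
  have V_ops: "V g \<in> bounded_ops" for g
    unfolding V_def by (intro compose_bounded_ops S X_ops rep_bounded_ops[OF rep])
  have V_0: "V 0 = id_blinfun"
    by (rule blinfun_eqI) (simp add: V_apply rep_zero[OF rep] SX)
  have V_add: "V (g + h) = V g o\<^sub>L V h" for g h
    by (rule blinfun_eqI) (simp add: V_apply SX rep_add[OF rep])
  have V_inner: "inner (V g x) (V g y) = inner x y" for g x y
    using S_inner[of "X x" "X y"] by (simp add: V_apply S_inner invariant SX)
  have V_inv: "V g o\<^sub>L V (- g) = id_blinfun" "V (- g) o\<^sub>L V g = id_blinfun" for g
    by (simp_all add: V_0 flip: V_add)
  \<comment> \<open>An isometry with inverse \<open>V (- g)\<close> has that inverse as its
    adjoint.\<close>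
  have cadjoint_V: "cadjoint (V g) = V (- g)" for g
  proof (rule cadjoint_eqI[OF V_ops V_ops])
    show "inner (V g x) y = inner x (V (- g) y)" for x y
      using V_inner[of g x "V (- g) y"] blinfun_apply_inverse[OF V_inv(1)] by simp
  qed
  have "continuous_map euclidean strong_operator_topology V"
    unfolding continuous_on_strong_operator_topo_iff_coordinatewise
    by (auto simp: V_apply intro!: continuous_intros continuous_on_rep[OF rep])
  then have "unitary_representation V"
    using V_ops V_0 V_add V_inv by (simp add: unitary_representation_def continuous_representation_def cadjoint_V)
  then show ?thesis
    using S X X_ops unfolding unitarizable_def inverse_ops_def V_def by blast
qed

lemma bounded_representation_unitarizable:
  fixes m :: "'g::{topological_group_add,t2_space} measure"
    and \<pi> :: "'g \<Rightarrow> ('h::complex_hilbert_space \<Rightarrow>\<^sub>L 'h)"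
  assumes "amenable m" and sets_m: "sets m = sets borel"
    and rep: "continuous_representation \<pi>" and bounded: "\<And>g. norm (\<pi> g) \<le> B"
  shows "unitarizable \<pi>"
proof -
  obtain M :: "('g \<Rightarrow> real) \<Rightarrow> real" where
    M: "\<And>f h. f \<in> Linfty m \<Longrightarrow> h \<in> Linfty m \<Longrightarrow> M (\<lambda>x. f x + h x) = M f + M h"
      "\<And>f c. f \<in> Linfty m \<Longrightarrow> M (\<lambda>x. c * f x) = c * M f"
      "\<And>f. f \<in> Linfty m \<Longrightarrow> AE x in m. 0 \<le> f x \<Longrightarrow> 0 \<le> M f"
      "M (\<lambda>x. 1) = 1"
    and M_inv: "\<And>f s. f \<in> Linfty m \<Longrightarrow> M (\<lambda>x. f (s + x)) = M f"
    using \<open>amenable m\<close> unfolding amenable_def by blast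
  \<comment> \<open>The maximum with 1 keeps \<open>D\<close> positive and gives
    \<open>1 / D\<^sup>2 \<le> D\<^sup>2\<close>, as required of the two form bounds.\<close>
  define D where "D = max 1 B"
  have D: "1 \<le> D" "norm (\<pi> g) \<le> D" for g
    using bounded[of g] by (auto simp: D_def)
  have norm_le: "norm (\<pi> g x) \<le> D * norm x" for g x
    using norm_blinfun[of "\<pi> g" x] mult_right_mono[OF D(2), of "norm x" g] by simp
  have norm_ge: "norm x \<le> D * norm (\<pi> g x)" for g x
    using norm_le[of "- g" "\<pi> g x"] by (simp add: rep_apply_add[OF rep] rep_zero[OF rep])
  \<comment> \<open>The inverse in the argument matches the left invariance of the mean: replacing
    \<open>x\<close>, \<open>y\<close> by \<open>\<pi> s x\<close>, \<open>\<pi> s y\<close> turns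
    \<open>g\<close> into \<open>- s + g\<close>.\<close>
  define f where "f x y g = inner (\<pi> (- g) x) (\<pi> (- g) y)" for x y g
  have f_le: "\<bar>f x y g\<bar> \<le> norm x * norm y * D\<^sup>2" for x y g
  proof -
    have "\<bar>f x y g\<bar> \<le> norm (\<pi> (- g) x) * norm (\<pi> (- g) y)"
      unfolding f_def by (rule Cauchy_Schwarz_ineq2)
    also have "\<dots> \<le> (D * norm x) * (D * norm y)"
      using D(1) by (intro mult_mono norm_le) auto
    finally show ?thesis by (simp add: power2_eq_square ac_simps)
  qed
  have f_Linfty: "f x y \<in> Linfty m" for x y
  proof -
    have "continuous_on UNIV (f x y)"
      unfolding f_def by (intro continuous_on_inner continuous_on_rep_uminus[OF rep])
    then have "f x y \<in> borel_measurable borel"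
      by (rule borel_measurable_continuous_onI)
    then have "f x y \<in> borel_measurable m"
      by (simp add: measurable_cong_sets[OF sets_m])
    then show ?thesis
      using f_le by (auto simp: Linfty_def intro!: exI[of _ "norm x * norm y * D\<^sup>2"])
  qed
  define b where "b x y = M (f x y)" for x y
  have b_le: "norm (b x y) \<le> norm x * norm y * D\<^sup>2" for x y
    unfolding b_def real_norm_def by (rule mean_abs_le[where m = m, OF M f_Linfty[of x y] f_le[of x y]])
  have "bounded_bilinear b"
  proof
    show "b (x + x') y = b x y + b x' y" for x x' y
      using M(1)[OF f_Linfty f_Linfty, of x y x' y] by (simp add: b_def f_def[abs_def] blinfun.add_right inner_add_left)
    show "b x (y + y') = b x y + b x y'" for x y y'
      using M(1)[OF f_Linfty f_Linfty, of x y x y'] by (simp add: b_def f_def[abs_def] blinfun.add_right inner_add_right)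
    show "b (r *\<^sub>R x) y = r *\<^sub>R b x y" for r x y
      using M(2)[OF f_Linfty, of r x y] by (simp add: b_def f_def[abs_def] blinfun.scaleR_right)
    show "b x (r *\<^sub>R y) = r *\<^sub>R b x y" for r x y
      using M(2)[OF f_Linfty, of r x y] by (simp add: b_def f_def[abs_def] blinfun.scaleR_right)
    show "\<exists>K. \<forall>x y. norm (b x y) \<le> norm x * norm y * K"
      using b_le by auto
  qed
  moreover have "b x y = b y x" for x y
    by (simp add: b_def f_def[abs_def] inner_commute)
  moreover have "b (c *\<^sub>C x) y = b x (cnj c *\<^sub>C y)" for c x y
    by (simp add: b_def f_def[abs_def] bounded_ops_scaleC[OF rep_bounded_ops[OF rep]] inner_scaleC_left)
  moreover have "b (\<pi> s x) (\<pi> s y) = b x y" for s x y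
  proof -
    have "f (\<pi> s x) (\<pi> s y) = (\<lambda>g. f x y (- s + g))"
      by (simp add: fun_eq_iff f_def rep_apply_add[OF rep] minus_add)
    then show ?thesis
      using M_inv[OF f_Linfty] by (simp add: b_def)
  qed
  moreover have "0 < 1 / D\<^sup>2"
    using D(1) by simp
  moreover have "1 / D\<^sup>2 * (norm x)\<^sup>2 \<le> b x x" for x
    unfolding b_def
  proof (rule mean_ge[where m = m, OF M f_Linfty[of x x]])
    fix g
    have "(norm x)\<^sup>2 \<le> (D * norm (\<pi> (- g) x))\<^sup>2"
      by (intro power_mono norm_ge) simp
    then show "1 / D\<^sup>2 * (norm x)\<^sup>2 \<le> f x x g"
      using D(1) by (simp add: f_def power_mult_distrib power2_norm_eq_inner field_simps)
  qed
  moreover have "b x x \<le> D\<^sup>2 * (norm x)\<^sup>2" for x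
    using b_le[of x x] by (simp add: abs_le_iff power2_eq_square ac_simps)
  moreover have "1 / D\<^sup>2 \<le> D\<^sup>2"
    using D(1) order_trans[of "1 / D\<^sup>2" 1 "D\<^sup>2"] by (simp add: one_le_power)
  ultimately show ?thesis
    by (rule invariant_form_imp_unitarizable[OF rep])
qed

theorem theorem2p2:
  fixes m :: "'g::{topological_group_add,t2_space} measure"
    and F :: "nat \<Rightarrow> 'g set"
    and p :: nat
    and K C :: real
    and \<pi> :: "'g \<Rightarrow> ('h::complex_hilbert_space \<Rightarrow>\<^sub>L 'h)"
  assumes "sigma_compact_space (euclidean :: 'g topology)"
    and "locally_compact_space (euclidean :: 'g topology)"
    and "right_haar_measure m"
    and "unimodular m"
    and "amenable m"
    and "symmetric_folner_sequence m F"
    and "(\<Union>N\<in>{1..}. F N) = UNIV"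
    and "p \<noteq> 0"
    and "K > 0"
    and "\<And>N. N \<ge> 1 \<Longrightarrow> {a + b | a b. a \<in> F N \<and> b \<in> uminus ` F N} \<subseteq> F (p * N)"
    and "\<And>N. N \<ge> 1 \<Longrightarrow> measure m (F (p * N)) / measure m (F N) \<le> K"
    and "continuous_representation \<pi>"
    and "\<And>g. \<exists>T. inverse_ops (\<pi> g) T"
    and "C \<ge> 1"
    and "\<And>N x. N \<ge> 1 \<Longrightarrow>
           1 / measure m (F N) * (LINT g:F N|m. (norm (blinfun_apply (\<pi> g) x))\<^sup>2)
             \<le> C\<^sup>2 * (norm x)\<^sup>2"
    and "\<And>N x. N \<ge> 1 \<Longrightarrow>
           1 / measure m (F N) * (LINT g:F N|m. (norm (blinfun_apply (cadjoint (\<pi> g)) x))\<^sup>2)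
             \<le> C\<^sup>2 * (norm x)\<^sup>2"
  shows "unitarizable \<pi>"
proof (rule bounded_representation_unitarizable[OF assms(5) _ assms(12)])
  interpret unimodular_group m
    by unfold_locales (fact assms)+
  show "sets m = sets borel"
    by simp
  have F: "compact (F N)" "uminus ` F N = F N" "0 < emeasure m (F N)" "emeasure m (F N) < \<infinity>" if "1 \<le> N" for N
    using assms(6) that by (auto simp: symmetric_folner_sequence_def)
  fix g
  \<comment> \<open>The sets \<open>F N\<close> exhaust the group, and the bound to be shown does
    not depend on \<open>N\<close>; so it is uniform in \<open>g\<close>.\<close>
  obtain N where N: "1 \<le> N" "g \<in> F N"
    using assms(7) by blast
  \<comment> \<open>Needed because the sequence and the mean bounds are controlled only from index 1
    on.\<close>
  then have pN: "1 \<le> p * N"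
    using assms(8) by simp
  show "norm (\<pi> g) \<le> (2 * C * (K + 1))\<^sup>2"
  proof (rule norm_rep_le[OF assms(12) F(1-3)[OF N(1)] F(1,3)[OF pN]])
    show "g - a \<in> F (p * N)" if "a \<in> F N" for a
      using assms(10)[OF N(1)] N(2) that by (force simp: diff_conv_add_uminus simp del: add_uminus_conv_diff)
    have "0 < measure m (F N)"
      using F(3,4)[OF N(1)] by (simp add: measure_def enn2real_positive_iff)
    then show "measure m (F (p * N)) \<le> K * measure m (F N)"
      using assms(11)[OF N(1)] by (simp add: field_simps)
  qed (use assms N pN in auto)
qed

end
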